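(* Let $X$ be a compact metric space and let $T : X \to X$ be a continuous surjective map. The following assertions are equivalent: (i) $(X,T)$ has uniformly positive entropy; (ii) $(\mathcal{M}_n(X),\widetilde{T})$ has uniformly positive entropy for some $1 \leq n \leq \infty$; (iii) $(\mathcal{M}_n(X),\widetilde{T})$ has uniformly positive entropy for every $1 \leq n \leq \infty$. Here, in (ii) and (iii), $n$ ranges over the positive integers together with $\infty$, and $\mathcal{M}_\infty(X) = \mathcal{M}(X)$ is the space of all Borel probability measures on $X$ with the weak$^*$ topology.
   Context: A topological dynamical system (TDS) is a pair $(X,T)$ where $X$ is a compact metric space and $T : X \to X$ is a continuous surjective map. Spaces of measures. $\mathcal{M}(X)$ denotes the space of all Borel probability measures on $X$ endowed with the weak$^*$ topology (the coarsest topology making $\mu \mapsto \int_X f\,d\mu$ continuous for every continuous $f : X \to \mathbb{R}$); it is compact and metrizable (for example by the Prohorov metric). For a positive integer $n$, $$\mathcal{M}_n(X) := \Big\{\tfrac{1}{n}\sum_{i=1}^n \delta_{x_i} \in \mathcal{M}(X) : x_1,\ldots,x_n \in X \text{ not necessarily distinct}\Big\},$$ with the subspace topology, where $\delta_x$ is the unit mass at $x$; and $\mathcal{M}_\infty(X) := \mathcal{M}(X)$. The induced map $\widetilde{T} : \mathcal{M}(X) \to \mathcal{M}(X)$ is $(\widetilde{T}(\mu))(A) := \mu(T^{-1}(A))$ for Borel $A \subset X$; it is continuous and surjective. Each $\mathcal{M}_n(X)$ is $\widetilde{T}$-invariant, and $\widetilde{T}$ also denotes the restricted map, so that $(\mathcal{M}_n(X),\widetilde{T})$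 is a TDS. Entropy. Let $(Y,S)$ be a TDS. For covers $\mathcal{U}_1,\ldots,\mathcal{U}_n$ of $Y$, let $\mathcal{U}_1 \vee \cdots \vee \mathcal{U}_n := \{U_1 \cap \cdots \cap U_n : U_i \in \mathcal{U}_i\}$. For an open cover $\mathcal{U}$ of $Y$, $N(\mathcal{U})$ denotes the minimum cardinality of a subcover of $\mathcal{U}$, and the topological entropy of $S$ with respect to $\mathcal{U}$ is $$h_{top}(S,\mathcal{U}) := \lim_{n \to \infty} \frac{1}{n} \log_2 N\big(\mathcal{U} \vee S^{-1}\mathcal{U} \vee \cdots \vee S^{-(n-1)}\mathcal{U}\big),$$ where $S^{-j}\mathcal{U} := \{S^{-j}(U) : U \in \mathcal{U}\}$. A standard cover of $Y$ is an open cover $\mathcal{U} = \{U,V\}$ of $Y$ consisting of two sets such that both $U$ and $V$ are non-dense in $Y$. The TDS $(Y,S)$ has uniformly positive entropy (UPE) if $h_{top}(S,\mathcal{U}) > 0$ for every standard cover $\mathcal{U}$ of $Y$. *)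

theory Defs
  imports "HOL-Probability.Probability"
begin

section \<open>Entropy of open covers and uniformly positive entropy\<close>

definition open_cover :: "'b topology \<Rightarrow> 'b set set \<Rightarrow> bool" where
  "open_cover Y \<U> \<longleftrightarrow> (\<forall>U\<in>\<U>. openin Y U) \<and> \<Union>\<U> = topspace Y"

text \<open>The finiteness requirement is there because \<^const>\<open>card\<close> is \<open>0\<close> on infinite sets. On a
  compact space every open cover has a finite subcover, so the minimum is attained.\<close>

definition subcover_number :: "'b topology \<Rightarrow> 'b set set \<Rightarrow> nat" where
  "subcover_number Y \<U> =
     (LEAST k. \<exists>\<V>. \<V> \<subseteq> \<U> \<and> finite \<V> \<and> topspace Y \<subseteq> \<Union>\<V> \<and> card \<V> = k)"

definition preimage_cover :: "'b topology \<Rightarrow> ('b \<Rightarrow> 'b) \<Rightarrow> 'b set set \<Rightarrow> 'b set set" where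
  "preimage_cover Y S \<U> = {{y \<in> topspace Y. S y \<in> U} | U. U \<in> \<U>}"

definition cover_join :: "nat \<Rightarrow> (nat \<Rightarrow> 'b set set) \<Rightarrow> 'b set set" where
  "cover_join n \<U> = {(\<Inter>j<n. U j) | U. \<forall>j<n. U j \<in> \<U> j}"

text \<open>For a continuous self-map of a compact space the limit exists (by subadditivity), so \<^const>\<open>lim\<close>
  denotes its value. The junk value of the sequence at \<open>n = 0\<close> does not affect it.\<close>

definition cover_entropy :: "'b topology \<Rightarrow> ('b \<Rightarrow> 'b) \<Rightarrow> 'b set set \<Rightarrow> real" where
  "cover_entropy Y S \<U> =
     lim (\<lambda>n. (1 / real n) *
       log 2 (real (subcover_number Y (cover_join n (\<lambda>j. preimage_cover Y (S ^^ j) \<U>)))))"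

definition standard_cover :: "'b topology \<Rightarrow> 'b set set \<Rightarrow> bool" where
  "standard_cover Y \<U> \<longleftrightarrow>
     (\<exists>U V. \<U> = {U, V} \<and> open_cover Y {U, V} \<and>
            Y closure_of U \<noteq> topspace Y \<and> Y closure_of V \<noteq> topspace Y)"

definition UPE :: "'b topology \<Rightarrow> ('b \<Rightarrow> 'b) \<Rightarrow> bool" where
  "UPE Y S \<longleftrightarrow> (\<forall>\<U>. standard_cover Y \<U> \<longrightarrow> cover_entropy Y S \<U> > 0)"


section \<open>Spaces of probability measures\<close>

text \<open>The carrier is \<^term>\<open>space (prob_algebra borel)\<close>, the set of Borel probability measures;
  taking the open set \<^const>\<open>UNIV\<close> below shows that it is the whole underlying set of the topology.
  The sets listed form the subbase of the coarsest topology making all integration functionals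
  continuous.\<close>

definition weak_star_topology :: "'a::topological_space measure topology" where
  "weak_star_topology = topology_generated_by
     {{\<mu> \<in> space (prob_algebra borel). (\<integral>x. f x \<partial>\<mu>) \<in> W} | (f :: 'a \<Rightarrow> real) W.
        continuous_on UNIV f \<and> open W}"

lemma topspace_weak_star_topology:
  "topspace weak_star_topology = {\<mu> :: 'a::topological_space measure. sets \<mu> = sets borel \<and> prob_space \<mu>}"
proof -
  let ?B = "{{\<mu> \<in> space (prob_algebra borel). (\<integral>x. f x \<partial>\<mu>) \<in> W} | (f :: 'a \<Rightarrow> real) W.
        continuous_on UNIV f \<and> open W}"
  have "space (prob_algebra borel) \<in> ?B"
    by (rule CollectI, rule exI[of _ "\<lambda>_. 0"], rule exI[of _ UNIV]) auto
  then have "\<Union>?B = space (prob_algebra borel)"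
    by blast
  then show ?thesis
    unfolding weak_star_topology_def topology_generated_by_topspace
    by (simp add: space_prob_algebra)
qed

definition measures_of_order :: "enat \<Rightarrow> 'a::topological_space measure set" where
  "measures_of_order n = (case n of
       enat k \<Rightarrow> {\<mu> \<in> space (prob_algebra borel). \<exists>x :: nat \<Rightarrow> 'a. \<forall>A\<in>sets borel.
                   measure \<mu> A = (1 / real k) * (\<Sum>i=1..k. measure (return borel (x i)) A)}
     | \<infinity> \<Rightarrow> space (prob_algebra borel))"

definition measure_space_of_order :: "enat \<Rightarrow> 'a::topological_space measure topology" where
  "measure_space_of_order n = subtopology weak_star_topology (measures_of_order n)"

definition induced_map :: "('a \<Rightarrow> 'a) \<Rightarrow> 'a::topological_space measure \<Rightarrow> 'a measure" where
  "induced_map T \<mu> = distr \<mu> borel T"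

end

theory Submission
  imports Defs
begin

text \<open>Positive entropy of a two-set cover \<open>{U, V}\<close> is equivalent to the existence, in each time window
  \<open>{..<n}\<close>, of a set \<open>J\<close> of size at least \<open>c n\<close> such that every pattern in \<open>{0, 1}\<close> on \<open>J\<close> is realised by an
  orbit visiting the complements of \<open>U\<close> and \<open>V\<close> accordingly. One direction is a counting argument; the
  other is a Sauer--Shelah lemma for partial words. Families of such independence sets are closed under
  subsets and downward shifts, so two families of positive density intersect in one of positive density.

  If \<open>T\<close> has uniformly positive entropy, then neighbourhoods of the atoms of two empirical measures with
  the same number of atoms have common independence sets, and empirical measures built from
  independently chosen orbits realise all patterns in the space of measures; empirical measures are
  dense, which covers the case \<open>n = \<infinity>\<close>. Conversely, a measure giving mass at least \<open>1 - \<eta>\<close> to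
  the prescribed set at each time in \<open>J\<close> yields a point following the pattern on at least
  \<open>(1 - \<eta>) card J\<close> times, and such approximate independence already forces exponential growth of the
  covering numbers.\<close>

section \<open>Shattering and binomial tails\<close>

text \<open>Chernoff's argument: for \<open>i \<le> k\<close> the weight \<open>x ^ i\<close> is at
  least \<open>x ^ k\<close>, and the fully weighted sum is \<open>(1 + x) ^ n\<close>.\<close>

lemma binomial_tail_le:
  fixes x :: real
  assumes "0 < x" "x \<le> 1"
  shows "(\<Sum>i\<le>k. real (n choose i)) \<le> (1 / x) ^ k * (1 + x) ^ n"
proof -
  have "x ^ k * (\<Sum>i\<le>k. real (n choose i)) \<le> (\<Sum>i\<le>k. real (n choose i) * x ^ i)"
    unfolding sum_distrib_left using assms
    by (intro sum_mono) (simp add: mult.commute[of "x ^ k"] mult_left_mono power_decreasing)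
  \<comment> \<open>\<open>k\<close> may exceed \<open>n\<close>; the larger index range contains
    both sums, and binomial coefficients beyond \<open>n\<close> vanish.\<close>
  also have "\<dots> \<le> (\<Sum>i\<le>max k n. real (n choose i) * x ^ i)"
    using assms by (intro sum_mono2) auto
  also have "\<dots> = (\<Sum>i\<le>n. real (n choose i) * x ^ i)"
    by (intro sum.mono_neutral_right) (auto simp: binomial_eq_0)
  also have "\<dots> = (1 + x) ^ n"
    using binomial_ring[of x 1 n] by (simp add: add.commute)
  finally show ?thesis
    using assms by (simp add: field_simps power_divide)
qed

text \<open>Both factors of the Chernoff bound are kept below \<open>2 powr (b / 2 * n)\<close>:
  first \<open>x\<close> is made small for \<open>(1 + x) ^ n\<close>, then \<open>c\<close> small
  for \<open>(1 / x) ^ k\<close>.\<close>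

lemma binomial_tail_exponential:
  fixes b :: real
  assumes "b > 0"
  obtains c :: real where "c > 0"
    "\<And>n k. real k \<le> c * real n \<Longrightarrow> (\<Sum>i\<le>k. real (n choose i)) \<le> 2 powr (b * real n)"
proof -
  define x where "x = min 1 (2 powr (b / 2) - 1)"
  have x: "0 < x" "x \<le> 1" "1 + x \<le> 2 powr (b / 2)"
    using assms by (auto simp: x_def powr_def)
  define L where "L = log 2 (1 / x)"
  have L: "L \<ge> 0" "1 / x = 2 powr L"
    using x by (auto simp: L_def)
  \<comment> \<open>\<open>L\<close> vanishes when \<open>x = 1\<close>, so the denominator has
    \<open>L + 1\<close>.\<close>
  define c where "c = b / (2 * (L + 1))"
  have c: "c > 0" "c * L \<le> b / 2"
    using assms L by (auto simp: c_def field_simps)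
  show thesis
  proof
    fix n k assume k: "real k \<le> c * real n"
    have "(\<Sum>i\<le>k. real (n choose i)) \<le> (1 / x) ^ k * (1 + x) ^ n"
      using x by (intro binomial_tail_le)
    also have "\<dots> \<le> (2 powr L) ^ k * (2 powr (b / 2)) ^ n"
      using x L by (intro mult_mono power_mono) auto
    also have "\<dots> = 2 powr (L * real k + b / 2 * real n)"
      by (simp add: powr_realpow[symmetric] powr_powr powr_add)
    also have "\<dots> \<le> 2 powr (b * real n)"
    proof -
      have "L * real k \<le> L * (c * real n)"
        using k L by (intro mult_left_mono) auto
      also have "\<dots> \<le> b / 2 * real n"
        using mult_right_mono[OF c(2), of "real n"] by (simp add: mult_ac)
      finally show ?thesis by simp
    qed
    finally show "(\<Sum>i\<le>k. real (n choose i)) \<le> 2 powr (b * real n)" .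
  qed (rule c)
qed

lemma card_subsets_card_le:
  assumes "finite A"
  shows "card {K. K \<subseteq> A \<and> card K \<le> k} = (\<Sum>i\<le>k. card A choose i)"
proof -
  have "{K. K \<subseteq> A \<and> card K \<le> k} = (\<Union>i\<in>{..k}. {K. K \<subseteq> A \<and> card K = i})"
    by auto
  also have "card \<dots> = (\<Sum>i\<le>k. card {K. K \<subseteq> A \<and> card K = i})"
    using assms by (intro card_UN_disjoint) auto
  finally show ?thesis
    using assms by (simp add: n_subsets)
qed

text \<open>A point may belong to neither \<open>R True j\<close> nor \<open>R False j\<close>, so this is shattering for a class of
  partial binary words.\<close>

definition shatters :: "(bool \<Rightarrow> nat \<Rightarrow> 'z set) \<Rightarrow> 'z set \<Rightarrow> nat set \<Rightarrow> bool" where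
  "shatters R Z J \<longleftrightarrow> (\<forall>\<sigma>. \<exists>z\<in>Z. \<forall>j\<in>J. z \<in> R (\<sigma> j) j)"

lemma shatters_mono: "shatters R Z J \<Longrightarrow> Z \<subseteq> Z' \<Longrightarrow> shatters R Z' J"
  unfolding shatters_def by (meson subsetD)

lemma shatters_empty_iff: "shatters R Z {} \<longleftrightarrow> Z \<noteq> {}"
  unfolding shatters_def by auto

lemma shatters_insert:
  assumes "\<And>b. shatters R (Z \<inter> R b n) J"
  shows "shatters R Z (insert n J)"
  unfolding shatters_def
proof
  fix \<sigma>
  obtain z where "z \<in> Z \<inter> R (\<sigma> n) n" "\<forall>j\<in>J. z \<in> R (\<sigma> j) j"
    using assms[of "\<sigma> n"] unfolding shatters_def by blast
  then show "\<exists>z\<in>Z. \<forall>j\<in>insert n J. z \<in> R (\<sigma> j) j"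
    by auto
qed

text \<open>A set counted twice on the left is shattered by both parts; it appears on the right as
  \<open>J\<close> and once more as \<open>insert n J\<close>, because either value at
  \<open>n\<close> can be prescribed.\<close>

lemma card_shattered_split:
  "card {J. J \<subseteq> {..<n} \<and> shatters R (Z \<inter> R True n) J}
     + card {J. J \<subseteq> {..<n} \<and> shatters R (Z \<inter> R False n) J}
   \<le> card {J. J \<subseteq> {..<Suc n} \<and> shatters R Z J}"
proof -
  define F where "F b = {J. J \<subseteq> {..<n} \<and> shatters R (Z \<inter> R b n) J}" for b
  define G where "G = {J. J \<subseteq> {..<Suc n} \<and> shatters R Z J}"
  have fin: "finite (F b)" for b
    by (rule finite_subset[of _ "Pow {..<n}"]) (auto simp: F_def)
  have finG: "finite G"
    by (rule finite_subset[of _ "Pow {..<Suc n}"]) (auto simp: G_def)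
  have notin: "n \<notin> J" if "J \<in> F b" for J b
    using that by (auto simp: F_def)
  have 1: "F True \<union> F False \<subseteq> G"
    unfolding F_def G_def by (auto intro: shatters_mono less_SucI)
  have 2: "insert n ` (F True \<inter> F False) \<subseteq> G"
  proof clarify
    fix J assume J: "J \<in> F True" "J \<in> F False"
    then have "shatters R (Z \<inter> R b n) J" for b
      by (cases b) (auto simp: F_def)
    then have "shatters R Z (insert n J)"
      by (rule shatters_insert)
    then show "insert n J \<in> G"
      using J by (auto simp: F_def G_def intro: less_SucI)
  qed
  have inj: "inj_on (insert n) (F True \<inter> F False)"
    using notin by (intro inj_onI) (metis Int_iff insert_ident)
  have "card (F True) + card (F False) = card (F True \<union> F False) + card (F True \<inter> F False)"
    by (rule card_Un_Int[OF fin fin])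
  also have "\<dots> = card (F True \<union> F False) + card (insert n ` (F True \<inter> F False))"
    by (simp add: card_image[OF inj])
  also have "\<dots> = card ((F True \<union> F False) \<union> insert n ` (F True \<inter> F False))"
    using notin fin by (intro card_Un_disjoint[symmetric]) auto
  also have "\<dots> \<le> card G"
    using 1 2 finG by (intro card_mono) auto
  finally show ?thesis
    by (simp add: F_def G_def)
qed

text \<open>Pascal's rule. In the coding argument the two sums bound the words without and with an
  exception at the last coordinate.\<close>

lemma sum_choose_Suc:
  "(\<Sum>i<Suc m. Suc n choose i) = (\<Sum>i<Suc m. n choose i) + (\<Sum>i<m. n choose i)"
  by (induction m) auto

text \<open>Codes are built one coordinate at a time. By \<open>card_shattered_split\<close> one of the two values of the
  last coordinate is taken on a subclass shattering at most half as many sets; that value is coded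
  as an exception, which can happen fewer than \<open>m\<close> times.\<close>

lemma card_codes_le:
  assumes "\<And>j. R True j \<inter> R False j = {}"
    and "card {J. J \<subseteq> {..<n} \<and> shatters R Z J} < 2 ^ m"
  shows "\<exists>C :: (nat \<Rightarrow> bool) set. finite C \<and> card C \<le> (\<Sum>i<m. n choose i) \<and>
           (\<forall>z\<in>Z. \<exists>s\<in>C. \<forall>j<n. z \<notin> R (s j) j)"
  using assms(2)
proof (induction n arbitrary: Z m)
  case 0
  show ?case
  proof (cases "Z = {}")
    case True
    then show ?thesis by (intro exI[of _ "{}"]) auto
  next
    case False
    \<comment> \<open>The empty set is shattered, so the hypothesis rules out \<open>m = 0\<close>
      and leaves room for one word.\<close>
    then have "{J. J \<subseteq> {..<0::nat} \<and> shatters R Z J} = {{}}"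
      by (auto simp: shatters_empty_iff)
    with 0 have "m > 0"
      by (cases m) auto
    then have "(\<Sum>i<m. 0 choose i) \<ge> (\<Sum>i\<in>{0}. 0 choose i)"
      by (intro sum_mono2) auto
    then show ?thesis by (intro exI[of _ "{\<lambda>_. True}"]) auto
  qed
next
  case (Suc n)
  let ?sh = "\<lambda>n Z. {J. J \<subseteq> {..<n} \<and> shatters R Z J}"
  have fin: "finite (?sh n Z)" for n Z
    by (rule finite_subset[of _ "Pow {..<n}"]) auto
  show ?case
  proof (cases m)
    case 0
    with Suc.prems fin have "?sh (Suc n) Z = {}" by auto
    then have "\<not> shatters R Z {}" by auto
    then show ?thesis by (intro exI[of _ "{}"]) (auto simp: shatters_empty_iff)
  next
    case (Suc m')
    have "card (?sh n (Z \<inter> R True n)) + card (?sh n (Z \<inter> R False n)) < 2 ^ m' + 2 ^ m'"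
      using card_shattered_split[of n R Z] Suc.prems Suc by simp
    then have "card (?sh n (Z \<inter> R True n)) < 2 ^ m' \<or> card (?sh n (Z \<inter> R False n)) < 2 ^ m'"
      by linarith
    then obtain b where b: "card (?sh n (Z \<inter> R b n)) < 2 ^ m'"
      by blast
    \<comment> \<open>Avoiding \<open>R b n\<close> by the letter \<open>b\<close> is the rule and
      keeps the budget \<open>m\<close>; points of \<open>R b n\<close> need the other letter, an
      exception paid for by the smaller budget \<open>m'\<close>.\<close>
    have "card (?sh n (Z - R b n)) \<le> card (?sh (Suc n) Z)"
      by (rule card_mono[OF fin]) (auto intro: shatters_mono less_SucI)
    with Suc.prems Suc have "card (?sh n (Z - R b n)) < 2 ^ Suc m'"
      by simp
    from Suc.IH[OF this] obtain C1 where C1: "finite C1" "card C1 \<le> (\<Sum>i<Suc m'. n choose i)"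
      "\<forall>z\<in>Z - R b n. \<exists>s\<in>C1. \<forall>j<n. z \<notin> R (s j) j" by blast
    from Suc.IH[OF b] obtain C2 where C2: "finite C2" "card C2 \<le> (\<Sum>i<m'. n choose i)"
      "\<forall>z\<in>Z \<inter> R b n. \<exists>s\<in>C2. \<forall>j<n. z \<notin> R (s j) j" by blast
    let ?C = "(\<lambda>s. s(n := b)) ` C1 \<union> (\<lambda>s. s(n := \<not> b)) ` C2"
    have "card ?C \<le> card C1 + card C2"
      by (meson C1(1) C2(1) add_mono card_Un_le card_image_le order_trans)
    also have "\<dots> \<le> (\<Sum>i<m. Suc n choose i)"
      using C1(2) C2(2) sum_choose_Suc[of n m'] unfolding Suc by linarith
    finally have card: "card ?C \<le> (\<Sum>i<m. Suc n choose i)" .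
    have "\<exists>s\<in>?C. \<forall>j<Suc n. z \<notin> R (s j) j" if z: "z \<in> Z" for z
    proof (cases "z \<in> R b n")
      case True
      then obtain s where s: "s \<in> C2" "\<forall>j<n. z \<notin> R (s j) j"
        using C2(3) z by blast
      have "z \<notin> R (\<not> b) n"
        using True assms(1)[of n] by (cases b) auto
      with s show ?thesis
        by (intro bexI[of _ "s(n := \<not> b)"]) (auto simp: less_Suc_eq)
    next
      case False
      then obtain s where s: "s \<in> C1" "\<forall>j<n. z \<notin> R (s j) j"
        using C1(3) z by blast
      with False show ?thesis
        by (intro bexI[of _ "s(n := b)"]) (auto simp: less_Suc_eq)
    qed
    with card C1(1) C2(1) show ?thesis
      by (intro exI[of _ ?C]) auto
  qed
qed

text \<open>Fekete's lemma. The limit is the infimum of the quotients, which is why it bounds every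
  single term.\<close>

lemma subadditive_tendsto:
  fixes a :: "nat \<Rightarrow> real"
  assumes "\<And>m n. a (m + n) \<le> a m + a n" and nonneg: "\<And>n. 0 \<le> a n"
  obtains L where "(\<lambda>n. a n / real n) \<longlonglongrightarrow> L" "\<And>n. L * real n \<le> a n"
proof -
  define L where "L = (INF n\<in>{0<..}. a n / real n)"
  have bdd: "bdd_below ((\<lambda>n. a n / real n) ` {0<..})"
    using nonneg by (intro bdd_belowI[of _ 0]) auto
  have L: "L \<le> a n / real n" if "n > 0" for n
    unfolding L_def using that by (intro cINF_lower[OF bdd]) auto
  have mult: "a (q * k) \<le> real q * a k" if "q > 0" for q k
    using that
  proof (induction q rule: nat_induct_non_zero)
    case (Suc q)
    have "a (Suc q * k) \<le> a (q * k) + a k"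
      using assms(1)[of "q * k" k] by (simp add: add.commute)
    with Suc show ?case by (simp add: algebra_simps)
  qed simp
  have "(\<lambda>n. a n / real n) \<longlonglongrightarrow> L"
  proof (rule LIMSEQ_I)
    fix e :: real assume e: "e > 0"
    obtain k where k: "k > 0" "a k / real k < L + e / 2"
      using e cINF_less_iff[OF _ bdd, of "L + e / 2"] by (auto simp: L_def)
    define M where "M = Max (a ` {..<2 * k})"
    have M: "a r \<le> M" if "r < 2 * k" for r
      unfolding M_def using that by (intro Max_ge) auto
    have M0: "M \<ge> 0"
      using M[of 0] nonneg[of 0] k by auto
    \<comment> \<open>Cut \<open>n\<close> into blocks of length \<open>k\<close>: each block costs
      at most \<open>a k\<close>, and the remainder at most \<open>M\<close>.\<close>
    have bound: "a n \<le> a k / real k * real n + M" for n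
    proof (cases "n < k")
      case True
      then have "a n \<le> M" by (intro M) auto
      then show ?thesis using nonneg[of k] by (simp add: add_increasing)
    next
      case False
      with k have q: "n div k > 0" by (simp add: div_greater_zero_iff)
      have "a n \<le> a (n div k * k) + a (n mod k)"
        using assms(1)[of "n div k * k" "n mod k"] by simp
      also have "\<dots> \<le> real (n div k) * a k + M"
        using k by (intro add_mono mult[OF q] M) (simp add: less_trans[OF mod_less_divisor])
      also have "real (n div k) * a k \<le> real n / real k * a k"
        using nonneg[of k] by (intro mult_right_mono) (simp_all add: of_nat_div_le_of_nat)
      finally show ?thesis by (simp add: mult.commute)
    qed
    obtain N where N: "real N > 2 * M / e" using reals_Archimedean2 by blast
    show "\<exists>no. \<forall>n\<ge>no. norm (a n / real n - L) < e"
    proof (intro exI allI impI)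
      fix n assume n: "n \<ge> Suc N"
      have "a n / real n \<le> a k / real k + M / real n"
        using bound[of n] n by (simp add: field_simps)
      also have "M / real n < e / 2"
      proof -
        have "2 * M / e < real n" using N n by linarith
        then show ?thesis using e n by (simp add: field_simps)
      qed
      finally show "norm (a n / real n - L) < e"
        using k L[of n] n by simp
    qed
  qed
  moreover have "L * real n \<le> a n" for n
    using L[of n] nonneg[of 0] by (cases "n = 0") (auto simp: field_simps)
  ultimately show thesis by (rule that)
qed

section \<open>Entropy and independence\<close>

text \<open>Distinct words may name the same member of the joined cover, and only their first
  \<open>n\<close> letters matter. Working with names lets words be concatenated and compared letter
  by letter.\<close>

definition covering_code ::
    "'b topology \<Rightarrow> ('b \<Rightarrow> 'b) \<Rightarrow> (bool \<Rightarrow> 'b set) \<Rightarrow> nat \<Rightarrow> (nat \<Rightarrow> bool) set \<Rightarrow> bool" where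
  "covering_code Y S W n C \<longleftrightarrow>
     finite C \<and> (\<forall>y\<in>topspace Y. \<exists>s\<in>C. \<forall>j<n. (S ^^ j) y \<in> W (s j))"

abbreviation iterated_cover :: "'b topology \<Rightarrow> ('b \<Rightarrow> 'b) \<Rightarrow> 'b set set \<Rightarrow> nat \<Rightarrow> 'b set set" where
  "iterated_cover Y S \<U> n \<equiv> cover_join n (\<lambda>j. preimage_cover Y (S ^^ j) \<U>)"

lemma funpow_in_topspace:
  assumes "S \<in> topspace Y \<rightarrow> topspace Y" "y \<in> topspace Y"
  shows "(S ^^ j) y \<in> topspace Y"
  using assms by (induction j) auto

lemma code_cell_in_iterated_cover:
  "(\<Inter>j<n. {y \<in> topspace Y. (S ^^ j) y \<in> W (s j)}) \<in> iterated_cover Y S (range W) n"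
  unfolding cover_join_def preimage_cover_def
  by (rule CollectI, rule exI[of _ "\<lambda>j. {y \<in> topspace Y. (S ^^ j) y \<in> W (s j)}"]) auto

lemma subcover_number_le_card_code:
  assumes "covering_code Y S W n C"
  shows "subcover_number Y (iterated_cover Y S (range W) n) \<le> card C"
proof -
  define E where "E s = (\<Inter>j<n. {y \<in> topspace Y. (S ^^ j) y \<in> W (s j)})" for s
  have fin: "finite C"
    using assms by (simp add: covering_code_def)
  have "E ` C \<subseteq> iterated_cover Y S (range W) n"
    unfolding E_def using code_cell_in_iterated_cover by fast
  moreover have "topspace Y \<subseteq> \<Union>(E ` C)"
  proof
    fix y assume y: "y \<in> topspace Y"
    then obtain s where "s \<in> C" "\<forall>j<n. (S ^^ j) y \<in> W (s j)"
      using assms by (auto simp: covering_code_def)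
    with y show "y \<in> \<Union>(E ` C)"
      by (auto simp: E_def)
  qed
  ultimately have "subcover_number Y (iterated_cover Y S (range W) n) \<le> card (E ` C)"
    unfolding subcover_number_def using fin by (intro Least_le) blast
  also have "\<dots> \<le> card C"
    by (rule card_image_le[OF fin])
  finally show ?thesis .
qed

lemma covering_code_exists:
  assumes S: "S \<in> topspace Y \<rightarrow> topspace Y" and W: "W True \<union> W False = topspace Y"
  shows "\<exists>C. covering_code Y S W n C"
proof -
  \<comment> \<open>Words are infinite; those that are \<open>False\<close> from \<open>n\<close> on
    correspond to subsets of the window, so they are finitely many.\<close>
  have "covering_code Y S W n ((\<lambda>D j. j \<in> D) ` Pow {..<n})"
    unfolding covering_code_def
  proof (intro conjI ballI)
    fix y assume y: "y \<in> topspace Y"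
    have "(S ^^ j) y \<in> W ((S ^^ j) y \<in> W True)" for j
      using funpow_in_topspace[OF S y, of j] W by (cases "(S ^^ j) y \<in> W True") auto
    then show "\<exists>s\<in>(\<lambda>D j. j \<in> D) ` Pow {..<n}. \<forall>j<n. (S ^^ j) y \<in> W (s j)"
      by (intro bexI[OF _ imageI[of "{j. j < n \<and> (S ^^ j) y \<in> W True}"]]) auto
  qed auto
  then show ?thesis ..
qed

text \<open>Some finite code exists, so the \<open>LEAST\<close> is attained. Naming each member of
  an optimal subcover gives a code that is no larger, and no code can be smaller.\<close>

lemma covering_code_subcover_number:
  assumes "S \<in> topspace Y \<rightarrow> topspace Y" and "W True \<union> W False = topspace Y"
  obtains C where "covering_code Y S W n C"
    "card C = subcover_number Y (iterated_cover Y S (range W) n)"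
proof -
  let ?J = "iterated_cover Y S (range W) n"
  let ?P = "\<lambda>k. \<exists>\<V>. \<V> \<subseteq> ?J \<and> finite \<V> \<and> topspace Y \<subseteq> \<Union>\<V> \<and> card \<V> = k"
  obtain C0 where C0: "covering_code Y S W n C0"
    using covering_code_exists[of S Y W n] assms by blast
  define E where "E s = (\<Inter>j<n. {y \<in> topspace Y. (S ^^ j) y \<in> W (s j)})" for s
  have "?P (card (E ` C0))"
  proof (intro exI[of _ "E ` C0"] conjI)
    show "E ` C0 \<subseteq> ?J"
      unfolding E_def using code_cell_in_iterated_cover by fast
    show "topspace Y \<subseteq> \<Union>(E ` C0)"
    proof
      fix y assume y: "y \<in> topspace Y"
      then obtain s where "s \<in> C0" "\<forall>j<n. (S ^^ j) y \<in> W (s j)"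
        using C0 by (auto simp: covering_code_def)
      with y show "y \<in> \<Union>(E ` C0)"
        by (auto simp: E_def)
    qed
  qed (use C0 in \<open>auto simp: covering_code_def\<close>)
  then have "?P (subcover_number Y ?J)"
    unfolding subcover_number_def by (rule LeastI)
  then obtain \<V> where \<V>: "\<V> \<subseteq> ?J" "finite \<V>" "topspace Y \<subseteq> \<Union>\<V>"
      "card \<V> = subcover_number Y ?J" by blast
  have "\<exists>s. \<forall>y\<in>B. \<forall>j<n. (S ^^ j) y \<in> W (s j)" if B: "B \<in> \<V>" for B
  proof -
    obtain A where A: "B = (\<Inter>j<n. A j)" "\<forall>j<n. A j \<in> preimage_cover Y (S ^^ j) (range W)"
      using B \<V>(1) by (auto simp: cover_join_def)
    then have "\<forall>j. \<exists>b. j < n \<longrightarrow> A j = {y \<in> topspace Y. (S ^^ j) y \<in> W b}"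
      by (fastforce simp: preimage_cover_def)
    then obtain s where "\<forall>j. j < n \<longrightarrow> A j = {y \<in> topspace Y. (S ^^ j) y \<in> W (s j)}"
      by metis
    with A(1) show ?thesis by blast
  qed
  then obtain s where s: "\<And>B y j. B \<in> \<V> \<Longrightarrow> y \<in> B \<Longrightarrow> j < n \<Longrightarrow> (S ^^ j) y \<in> W (s B j)"
    by metis
  have "covering_code Y S W n (s ` \<V>)"
    unfolding covering_code_def
  proof (intro conjI ballI)
    show "finite (s ` \<V>)" using \<V>(2) by simp
    fix y assume "y \<in> topspace Y"
    then obtain B where "B \<in> \<V>" "y \<in> B" using \<V>(3) by blast
    then show "\<exists>s'\<in>s ` \<V>. \<forall>j<n. (S ^^ j) y \<in> W (s' j)"
      using s by blast
  qed
  moreover have "card (s ` \<V>) = subcover_number Y ?J"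
    using subcover_number_le_card_code[OF calculation] card_image_le[OF \<V>(2), of s] \<V>(4) by simp
  ultimately show thesis by (rule that)
qed

text \<open>Concatenate a word for the first \<open>m\<close> steps of \<open>y\<close> with one for
  \<open>n\<close> steps of the orbit of \<open>(S ^^ m) y\<close>.\<close>

lemma subcover_number_submult:
  assumes S: "S \<in> topspace Y \<rightarrow> topspace Y" and W: "W True \<union> W False = topspace Y"
  shows "subcover_number Y (iterated_cover Y S (range W) (m + n))
    \<le> subcover_number Y (iterated_cover Y S (range W) m)
      * subcover_number Y (iterated_cover Y S (range W) n)"
proof -
  obtain C where C: "covering_code Y S W m C"
    "card C = subcover_number Y (iterated_cover Y S (range W) m)"
    using covering_code_subcover_number[OF assms] .
  obtain D where D: "covering_code Y S W n D"
    "card D = subcover_number Y (iterated_cover Y S (range W) n)"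
    using covering_code_subcover_number[OF assms] .
  define f where "f = (\<lambda>(s, t) j. if j < m then s j else t (j - m) :: bool)"
  have "covering_code Y S W (m + n) (f ` (C \<times> D))"
    unfolding covering_code_def
  proof (intro conjI ballI)
    show "finite (f ` (C \<times> D))"
      using C(1) D(1) by (simp add: covering_code_def)
    fix y assume y: "y \<in> topspace Y"
    obtain s where s: "s \<in> C" "\<forall>j<m. (S ^^ j) y \<in> W (s j)"
      using C(1) y by (auto simp: covering_code_def)
    obtain t where t: "t \<in> D" "\<forall>j<n. (S ^^ j) ((S ^^ m) y) \<in> W (t j)"
      using D(1) funpow_in_topspace[OF S y, of m] by (auto simp: covering_code_def)
    have "(S ^^ j) y \<in> W (f (s, t) j)" if "j < m + n" for j
    proof (cases "j < m")
      case True
      then show ?thesis using s by (simp add: f_def)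
    next
      case False
      then have "(S ^^ j) y = (S ^^ (j - m)) ((S ^^ m) y)"
        by (metis comp_apply funpow_add le_add_diff_inverse2 not_less)
      then show ?thesis using False that t by (simp add: f_def)
    qed
    with s t show "\<exists>u\<in>f ` (C \<times> D). \<forall>j<m + n. (S ^^ j) y \<in> W (u j)"
      by blast
  qed
  then have "subcover_number Y (iterated_cover Y S (range W) (m + n)) \<le> card (f ` (C \<times> D))"
    by (rule subcover_number_le_card_code)
  also have "\<dots> \<le> card (C \<times> D)"
    using C(1) D(1) by (intro card_image_le) (simp add: covering_code_def)
  finally show ?thesis
    by (simp add: card_cartesian_product C(2) D(2))
qed

text \<open>Submultiplicativity becomes subadditivity of the logarithms, so Fekete's lemma makes the
  \<open>lim\<close> in the entropy a genuine limit, approached from above.\<close>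

lemma cover_entropy_tendsto:
  assumes S: "S \<in> topspace Y \<rightarrow> topspace Y" and W: "W True \<union> W False = topspace Y"
  defines "a \<equiv> \<lambda>n. log 2 (real (subcover_number Y (iterated_cover Y S (range W) n)))"
  shows "(\<lambda>n. a n / real n) \<longlonglongrightarrow> cover_entropy Y S (range W)"
    and "cover_entropy Y S (range W) * real n \<le> a n"
proof -
  let ?N = "\<lambda>n. subcover_number Y (iterated_cover Y S (range W) n)"
  \<comment> \<open>On an empty space the covering number is \<open>0\<close>, where
    \<open>log\<close> takes the default value \<open>0\<close>.\<close>
  have nonneg: "0 \<le> a n" for n
    by (cases "?N n") (auto simp: a_def log_def)
  have sub: "a (m + n) \<le> a m + a n" for m n
  proof (cases "?N (m + n) = 0")
    case True
    then have "a (m + n) = 0" by (simp add: a_def log_def)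
    then show ?thesis using nonneg[of m] nonneg[of n] by simp
  next
    case False
    have le: "?N (m + n) \<le> ?N m * ?N n"
      by (rule subcover_number_submult[OF S W])
    with False have "?N m * ?N n > 0" by linarith
    then have pos: "?N m > 0" "?N n > 0" by simp_all
    have "a (m + n) \<le> log 2 (real (?N m * ?N n))"
      unfolding a_def
    proof (rule log_le_cancel_iff[THEN iffD2])
      show "real (?N (m + n)) \<le> real (?N m * ?N n)"
        using le by (simp only: of_nat_le_iff)
    qed (use False pos in auto)
    also have "\<dots> = a m + a n"
      using pos by (simp add: a_def log_mult)
    finally show ?thesis .
  qed
  obtain L where L: "(\<lambda>n. a n / real n) \<longlonglongrightarrow> L" "\<And>n. L * real n \<le> a n"
    using subadditive_tendsto[of a, OF sub nonneg] by blast
  have "cover_entropy Y S (range W) = L"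
    unfolding cover_entropy_def using L(1) by (intro limI) (simp add: a_def)
  with L show "(\<lambda>n. a n / real n) \<longlonglongrightarrow> cover_entropy Y S (range W)"
    "cover_entropy Y S (range W) * real n \<le> a n"
    by simp_all
qed

section \<open>Independence sets and positive entropy\<close>

text \<open>The windows are treated separately: the members found for different \<open>n\<close>
  need not be related.\<close>

definition positive_density :: "nat set set \<Rightarrow> bool" where
  "positive_density F \<longleftrightarrow>
     (\<exists>c>0. \<forall>n>0. \<exists>J\<in>F. J \<subseteq> {..<n} \<and> c * real n \<le> real (card J))"

text \<open>The independence sets of local entropy theory for the pair \<open>A True\<close>,
  \<open>A False\<close>, phrased as shattering so that the coding lemma applies to them.\<close>

definition independence_sets :: "('b \<Rightarrow> 'b) \<Rightarrow> 'b set \<Rightarrow> (bool \<Rightarrow> 'b set) \<Rightarrow> nat set set" where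
  "independence_sets S \<Omega> A = {J. shatters (\<lambda>b j. (S ^^ j) -` A b) \<Omega> J}"

lemma mem_independence_sets_iff:
  "J \<in> independence_sets S \<Omega> A \<longleftrightarrow> (\<forall>\<sigma>. \<exists>y\<in>\<Omega>. \<forall>j\<in>J. (S ^^ j) y \<in> A (\<sigma> j))"
  by (simp add: independence_sets_def shatters_def)

lemma positive_density_mono: "positive_density F \<Longrightarrow> F \<subseteq> G \<Longrightarrow> positive_density G"
  unfolding positive_density_def by (meson subsetD)

lemma independence_sets_mono:
  "(\<And>b. A b \<subseteq> B b) \<Longrightarrow> independence_sets S \<Omega> A \<subseteq> independence_sets S \<Omega> B"
  by (auto simp: mem_independence_sets_iff) (meson subsetD)

text \<open>If all independence sets in a window were small, there would be fewer than
  \<open>2 ^ Suc l\<close> of them, and the coding lemma would give a code too small for the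
  entropy.\<close>

lemma positive_density_if_entropy_pos:
  assumes S: "S \<in> topspace Y \<rightarrow> topspace Y" and W: "W True \<union> W False = topspace Y"
    and pos: "cover_entropy Y S (range W) > 0"
  shows "positive_density (independence_sets S (topspace Y) (\<lambda>b. topspace Y - W b))"
proof -
  define L where "L = cover_entropy Y S (range W)"
  define R where "R b j = (S ^^ j) -` (topspace Y - W b)" for b j
  have L: "L > 0" using pos by (simp add: L_def)
  \<comment> \<open>The constants are nested: \<open>e\<close> keeps the number of words with up to
    \<open>e * n\<close> exceptions below half the entropy rate, then \<open>c\<close> keeps the
    number of sets of size up to \<open>c * n\<close> below \<open>2 powr (e * n)\<close>.\<close>
  obtain e where e: "e > 0"
    "\<And>n k. real k \<le> e * real n \<Longrightarrow> (\<Sum>i\<le>k. real (n choose i)) \<le> 2 powr (L / 2 * real n)"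
    using binomial_tail_exponential[of "L / 2"] L by auto
  obtain c where c: "c > 0"
    "\<And>n k. real k \<le> c * real n \<Longrightarrow> (\<Sum>i\<le>k. real (n choose i)) \<le> 2 powr (e * real n)"
    using binomial_tail_exponential[of e] e(1) by auto
  have disj: "R True j \<inter> R False j = {}" for j
    using W by (auto simp: R_def)
  have "\<exists>J. shatters R (topspace Y) J \<and> J \<subseteq> {..<n} \<and> c * real n \<le> real (card J)" if n: "n > 0" for n
  proof (rule ccontr)
    assume contra: "\<not> ?thesis"
    define k where "k = nat \<lfloor>c * real n\<rfloor>"
    define l where "l = nat \<lfloor>e * real n\<rfloor>"
    have kl: "real k \<le> c * real n" "real l \<le> e * real n"
      using c(1) e(1) by (auto simp: k_def l_def)
    let ?F = "{J. J \<subseteq> {..<n} \<and> shatters R (topspace Y) J}"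
    have "?F \<subseteq> {J. J \<subseteq> {..<n} \<and> card J \<le> k}"
      using contra by (auto simp: k_def not_le le_nat_floor)
    then have "card ?F \<le> card {J. J \<subseteq> {..<n} \<and> card J \<le> k}"
      by (rule card_mono[rotated]) (auto intro: finite_subset[of _ "Pow {..<n}"])
    also have "\<dots> = (\<Sum>i\<le>k. n choose i)"
      by (simp add: card_subsets_card_le)
    finally have "real (card ?F) \<le> (\<Sum>i\<le>k. real (n choose i))"
      unfolding of_nat_sum[symmetric] of_nat_le_iff .
    also have "\<dots> \<le> 2 powr (e * real n)"
      by (rule c(2)[OF kl(1)])
    \<comment> \<open>Rounding down to \<open>l\<close> loses less than one, so the exponent
      \<open>Suc l\<close> gives a strict bound; the code then counts \<open>i < Suc l\<close>, that
      is, \<open>i \<le> l\<close>.\<close>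
    also have "\<dots> < 2 powr (real (Suc l))"
    proof -
      have "e * real n < real (Suc l)"
        unfolding l_def by linarith
      then show ?thesis by simp
    qed
    also have "\<dots> = real (2 ^ Suc l)"
      by (subst powr_realpow) auto
    finally have "card ?F < 2 ^ Suc l"
      unfolding of_nat_less_iff .
    from card_codes_le[OF disj this] obtain C where C: "finite C"
      "card C \<le> (\<Sum>i<Suc l. n choose i)"
      "\<forall>z\<in>topspace Y. \<exists>s\<in>C. \<forall>j<n. z \<notin> R (s j) j" by blast
    have "covering_code Y S W n C"
      unfolding covering_code_def
    proof (intro conjI ballI)
      fix y assume y: "y \<in> topspace Y"
      then obtain s where "s \<in> C" "\<forall>j<n. y \<notin> R (s j) j" using C(3) by blast
      then show "\<exists>s\<in>C. \<forall>j<n. (S ^^ j) y \<in> W (s j)"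
        using funpow_in_topspace[OF S y] by (auto simp: R_def)
    qed (rule C)
    from subcover_number_le_card_code[OF this]
    have "subcover_number Y (iterated_cover Y S (range W) n) \<le> (\<Sum>i\<le>l. n choose i)"
      using C(2) by (simp add: lessThan_Suc_atMost)
    then have "real (subcover_number Y (iterated_cover Y S (range W) n)) \<le> (\<Sum>i\<le>l. real (n choose i))"
      unfolding of_nat_sum[symmetric] of_nat_le_iff .
    also have "\<dots> \<le> 2 powr (L / 2 * real n)"
      by (rule e(2)[OF kl(2)])
    finally have N: "real (subcover_number Y (iterated_cover Y S (range W) n)) \<le> 2 powr (L / 2 * real n)" .
    have "L * real n \<le> log 2 (real (subcover_number Y (iterated_cover Y S (range W) n)))"
      unfolding L_def by (rule cover_entropy_tendsto(2)[OF S W])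
    moreover have "L * real n > 0" using L n by simp
    \<comment> \<open>A covering number \<open>0\<close> would have logarithm \<open>0\<close>,
      below the positive \<open>L * real n\<close>.\<close>
    ultimately have Npos: "subcover_number Y (iterated_cover Y S (range W) n) > 0"
      by (cases "subcover_number Y (iterated_cover Y S (range W) n)") (auto simp: log_def)
    with N have "log 2 (real (subcover_number Y (iterated_cover Y S (range W) n))) \<le> L / 2 * real n"
      by (subst log_le_iff) auto
    with \<open>L * real n \<le> _\<close> \<open>L * real n > 0\<close> show False by simp
  qed
  with c(1) show ?thesis
    unfolding positive_density_def independence_sets_def R_def[abs_def] by blast
qed

text \<open>A code word covers the chosen point of a pattern \<open>\<sigma>\<close> only if it differs from \<open>\<sigma>\<close> on all but at
  most \<open>\<eta> * card J\<close> elements of \<open>J\<close>, that is, only for \<open>\<sigma>\<close> in a small Hamming ball.\<close>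

lemma entropy_pos_if_almost_independent:
  assumes S: "S \<in> topspace Y \<rightarrow> topspace Y" and W: "W True \<union> W False = topspace Y"
    and tail: "\<And>n k. real k \<le> \<eta> * real n \<Longrightarrow> (\<Sum>i\<le>k. real (n choose i)) \<le> 2 powr (real n / 2)"
    and "\<eta> > 0" "c > 0"
    and indep: "\<And>n. n > 0 \<Longrightarrow> \<exists>J\<subseteq>{..<n}. c * real n \<le> real (card J) \<and>
       (\<forall>\<sigma>. \<exists>y\<in>topspace Y. (1 - \<eta>) * real (card J) \<le> real (card {j \<in> J. (S ^^ j) y \<notin> W (\<sigma> j)}))"
  shows "cover_entropy Y S (range W) > 0"
proof -
  let ?N = "\<lambda>n. subcover_number Y (iterated_cover Y S (range W) n)"
  have "c / 2 \<le> log 2 (real (?N n)) / real n" if n: "n > 0" for n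
  proof -
    obtain J where J: "J \<subseteq> {..<n}" "c * real n \<le> real (card J)"
      and y: "\<And>\<sigma>. \<exists>y\<in>topspace Y. (1 - \<eta>) * real (card J) \<le> real (card {j \<in> J. (S ^^ j) y \<notin> W (\<sigma> j)})"
      using indep[OF n] by blast
    have finJ: "finite J" using J(1) finite_subset by blast
    obtain C where C: "covering_code Y S W n C" "card C = ?N n"
      using covering_code_subcover_number[OF S W] .
    have finC: "finite C" using C(1) by (simp add: covering_code_def)
    define k where "k = nat \<lfloor>\<eta> * real (card J)\<rfloor>"
    \<comment> \<open>A pattern is encoded by the set \<open>D\<close> of times with value
      \<open>True\<close>; \<open>B s\<close> holds the patterns that agree with the word
      \<open>s\<close> at most \<open>k\<close> times.\<close>
    define B where "B s = {D. D \<subseteq> J \<and> card {j \<in> J. (j \<in> D) = s j} \<le> k}" for s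
    have card_B: "card (B s) \<le> (\<Sum>i\<le>k. card J choose i)" for s
    proof -
      \<comment> \<open>The set of agreements with the fixed word \<open>s\<close> determines the
        pattern.\<close>
      have "inj_on (\<lambda>D. {j \<in> J. (j \<in> D) = s j}) (B s)"
      proof (rule inj_onI)
        fix D D' assume D: "D \<in> B s" "D' \<in> B s"
          and eq: "{j \<in> J. (j \<in> D) = s j} = {j \<in> J. (j \<in> D') = s j}"
        have "j \<in> D \<longleftrightarrow> j \<in> D'" if "j \<in> J" for j
          using eq that by (auto simp: set_eq_iff)
        then show "D = D'" using D by (auto simp: B_def)
      qed
      then have "card (B s) \<le> card {K. K \<subseteq> J \<and> card K \<le> k}"
        by (rule card_inj_on_le) (use finJ in \<open>auto simp: B_def\<close>)
      then show ?thesis by (simp add: card_subsets_card_le[OF finJ])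
    qed
    have "Pow J \<subseteq> (\<Union>s\<in>C. B s)"
    proof
      fix D assume D: "D \<in> Pow J"
      obtain y where y: "y \<in> topspace Y"
        "(1 - \<eta>) * real (card J) \<le> real (card {j \<in> J. (S ^^ j) y \<notin> W (j \<in> D)})"
        using y[of "\<lambda>j. j \<in> D"] by blast
      obtain s where s: "s \<in> C" "\<forall>j<n. (S ^^ j) y \<in> W (s j)"
        using C(1) y(1) by (auto simp: covering_code_def)
      let ?E = "{j \<in> J. (j \<in> D) = s j}"
      \<comment> \<open>The orbit lies in \<open>W (s j)\<close> throughout the window, so where it
        avoids \<open>W (j \<in> D)\<close> the word disagrees with the pattern.\<close>
      have "{j \<in> J. (S ^^ j) y \<notin> W (j \<in> D)} \<subseteq> J - ?E"
        using s(2) J(1) by auto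
      then have "card {j \<in> J. (S ^^ j) y \<notin> W (j \<in> D)} \<le> card (J - ?E)"
        by (rule card_mono[rotated]) (use finJ in auto)
      also have "\<dots> = card J - card ?E"
        using finJ by (intro card_Diff_subset) auto
      finally have "real (card {j \<in> J. (S ^^ j) y \<notin> W (j \<in> D)}) \<le> real (card J) - real (card ?E)"
        using card_mono[OF finJ, of ?E] by auto
      with y(2) have "real (card ?E) \<le> \<eta> * real (card J)"
        by (simp add: algebra_simps)
      then have "card ?E \<le> k"
        unfolding k_def by (rule le_nat_floor)
      with D s(1) show "D \<in> (\<Union>s\<in>C. B s)"
        by (auto simp: B_def)
    qed
    moreover have "finite (\<Union>s\<in>C. B s)"
      using finC finJ by (auto simp: B_def)
    ultimately have "card (Pow J) \<le> card (\<Union>s\<in>C. B s)"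
      by (intro card_mono)
    also have "\<dots> \<le> (\<Sum>s\<in>C. card (B s))"
      by (rule card_UN_le[OF finC])
    also have "\<dots> \<le> card C * (\<Sum>i\<le>k. card J choose i)"
      using sum_bounded_above[OF card_B] by simp
    finally have "2 ^ card J \<le> card C * (\<Sum>i\<le>k. card J choose i)"
      by (simp add: card_Pow finJ)
    then have "real (2 ^ card J) \<le> real (card C * (\<Sum>i\<le>k. card J choose i))"
      by (rule of_nat_mono)
    also have "\<dots> \<le> real (card C) * 2 powr (real (card J) / 2)"
      unfolding of_nat_mult of_nat_sum using \<open>\<eta> > 0\<close>
      by (intro mult_left_mono tail) (auto simp: k_def)
    finally have "2 powr (real (card J)) \<le> real (card C) * 2 powr (real (card J) / 2)"
      by (simp add: powr_realpow)
    \<comment> \<open>Half of the exponent pays for the size of the Hamming balls; cancelling it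
      leaves the other half for the code.\<close>
    also have "2 powr (real (card J)) = 2 powr (real (card J) / 2) * 2 powr (real (card J) / 2)"
      by (simp flip: powr_add)
    finally have N: "2 powr (real (card J) / 2) \<le> real (?N n)"
      using C(2) by simp
    then have "real (?N n) > 0"
      by (rule less_le_trans[rotated]) simp
    with N have "real (card J) / 2 \<le> log 2 (real (?N n))"
      by (subst le_log_iff) auto
    with J(2) have "c / 2 * real n \<le> log 2 (real (?N n))" by simp
    then show ?thesis using n by (simp add: field_simps)
  qed
  then have "c / 2 \<le> cover_entropy Y S (range W)"
    by (intro LIMSEQ_le_const[OF cover_entropy_tendsto(1)[OF S W]] exI[of _ 1]) auto
  with \<open>c > 0\<close> show ?thesis by simp
qed

section \<open>Hereditary families of time sets\<close>

text \<open>One condition for both closure properties: \<open>k = 0\<close> gives subsets,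
  \<open>k > 0\<close> gives subsets of downward shifts.\<close>

definition shift_hereditary :: "nat set set \<Rightarrow> bool" where
  "shift_hereditary F \<longleftrightarrow> (\<forall>J\<in>F. \<forall>K k. (\<forall>j\<in>K. j + k \<in> J) \<longrightarrow> K \<in> F)"

lemma shift_hereditaryD:
  "shift_hereditary F \<Longrightarrow> J \<in> F \<Longrightarrow> (\<And>j. j \<in> K \<Longrightarrow> j + k \<in> J) \<Longrightarrow> K \<in> F"
  unfolding shift_hereditary_def by blast

text \<open>If the orbit of \<open>y\<close> follows a pattern at the times \<open>j + k\<close>,
  that of \<open>(S ^^ k) y\<close> follows it at the times \<open>j\<close>.\<close>

lemma shift_hereditary_independence_sets:
  assumes "S \<in> \<Omega> \<rightarrow> \<Omega>"
  shows "shift_hereditary (independence_sets S \<Omega> A)"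
  unfolding shift_hereditary_def
proof (intro ballI allI impI)
  fix J K k assume J: "J \<in> independence_sets S \<Omega> A" and K: "\<forall>j\<in>K. j + k \<in> J"
  have inv: "(S ^^ m) y \<in> \<Omega>" if "y \<in> \<Omega>" for m y
    using assms that by (induction m) auto
  show "K \<in> independence_sets S \<Omega> A"
    unfolding mem_independence_sets_iff
  proof
    fix \<sigma>
    \<comment> \<open>Truncation in \<open>i - k\<close> is harmless: only times of the form
      \<open>j + k\<close> are used below.\<close>
    obtain y where y: "y \<in> \<Omega>" "\<forall>i\<in>J. (S ^^ i) y \<in> A (\<sigma> (i - k))"
      using J[unfolded mem_independence_sets_iff, rule_format, of "\<lambda>i. \<sigma> (i - k)"] by blast
    have "(S ^^ j) ((S ^^ k) y) \<in> A (\<sigma> j)" if "j \<in> K" for j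
    proof -
      have "(S ^^ (j + k)) y \<in> A (\<sigma> (j + k - k))"
        using y(2) K that by blast
      then show ?thesis by (simp add: funpow_add)
    qed
    then show "\<exists>y\<in>\<Omega>. \<forall>j\<in>K. (S ^^ j) y \<in> A (\<sigma> j)"
      using inv[OF y(1)] by blast
  qed
qed

text \<open>Some translate of one set meets the other in a set of proportional size: pigeonhole on the
  differences of pairs of elements.\<close>

lemma positive_density_Int:
  assumes F: "shift_hereditary F" "positive_density F"
    and G: "shift_hereditary G" "positive_density G"
  shows "positive_density (F \<inter> G)"
proof -
  obtain c where c: "c > 0" "\<And>n. n > 0 \<Longrightarrow> \<exists>J\<in>F. J \<subseteq> {..<n} \<and> c * real n \<le> real (card J)"
    using F(2) unfolding positive_density_def by blast
  obtain e where e: "e > 0" "\<And>n. n > 0 \<Longrightarrow> \<exists>J\<in>G. J \<subseteq> {..<n} \<and> e * real n \<le> real (card J)"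
    using G(2) unfolding positive_density_def by blast
  have "\<exists>K\<in>F \<inter> G. K \<subseteq> {..<n} \<and> c * e / 2 * real n \<le> real (card K)" if n: "n > 0" for n
  proof -
    obtain I where I: "I \<in> F" "I \<subseteq> {..<n}" "c * real n \<le> real (card I)" using c(2)[OF n] by blast
    obtain J where J: "J \<in> G" "J \<subseteq> {..<n}" "e * real n \<le> real (card J)" using e(2)[OF n] by blast
    have fin: "finite I" "finite J" using I(2) J(2) finite_subset by blast+
    \<comment> \<open>\<open>d\<close> records the difference \<open>i - j\<close>, offset by
      \<open>n\<close> to stay a natural number below \<open>2 * n\<close>.\<close>
    define P where "P d = {(i, j) \<in> I \<times> J. i + n = j + d}" for d
    have finP: "finite (P d)" for d
      by (rule finite_subset[of _ "I \<times> J"]) (use fin in \<open>auto simp: P_def\<close>)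
    have "I \<times> J \<subseteq> (\<Union>d<2 * n. P d)"
    proof clarify
      fix i j assume ij: "i \<in> I" "j \<in> J"
      then have "i < n" "j < n" using I J by auto
      then have "i + n - j < 2 * n" "i + n = j + (i + n - j)" by auto
      with ij show "(i, j) \<in> (\<Union>d<2 * n. P d)"
        unfolding P_def by blast
    qed
    then have "card (I \<times> J) \<le> card (\<Union>d<2 * n. P d)"
      using finP by (intro card_mono) auto
    also have "\<dots> \<le> (\<Sum>d<2 * n. card (P d))"
      by (rule card_UN_le) simp
    finally have sum: "card I * card J \<le> (\<Sum>d<2 * n. card (P d))"
      by (simp add: card_cartesian_product)
    obtain d where d: "card I * card J \<le> 2 * n * card (P d)"
    proof (rule ccontr)
      assume "\<not> thesis"
      with that have "2 * n * card (P d) < card I * card J" for d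
        by (meson not_le)
      then have "(\<Sum>d<2 * n. 2 * n * card (P d)) < (\<Sum>d<2 * n. card I * card J)"
        using n by (intro sum_strict_mono) (auto simp: lessThan_empty_iff)
      then have "2 * n * (\<Sum>d<2 * n. card (P d)) < 2 * n * (card I * card J)"
        by (simp add: sum_distrib_left)
      with sum show False by simp
    qed
    \<comment> \<open>\<open>K\<close> consists of the times of one set whose upward translate lands
      in the other, so it is a subset of the former and a downward shift of part of the latter. The
      sign of \<open>d - n\<close> decides the roles.\<close>
    have "\<exists>K\<in>F \<inter> G. K \<subseteq> {..<n} \<and> card (P d) \<le> card K"
    proof (cases "d \<ge> n")
      case True
      define K where "K = {j \<in> J. j + (d - n) \<in> I}"
      have "K \<in> F" by (rule shift_hereditaryD[OF F(1) I(1), of _ "d - n"]) (simp add: K_def)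
      moreover have "K \<in> G" by (rule shift_hereditaryD[OF G(1) J(1), of _ 0]) (simp add: K_def)
      moreover have "card (P d) \<le> card K"
      proof (rule card_inj_on_le[of snd])
        show "inj_on snd (P d)" by (auto simp: inj_on_def P_def)
        have "j + (d - n) = i" if "i + n = j + d" for i j
          using that True by linarith
        then show "snd ` P d \<subseteq> K" by (auto simp: K_def P_def)
      qed (use fin in \<open>simp add: K_def\<close>)
      ultimately show ?thesis using J(2) by (intro bexI[of _ K]) (auto simp: K_def)
    next
      case False
      define K where "K = {i \<in> I. i + (n - d) \<in> J}"
      have "K \<in> G" by (rule shift_hereditaryD[OF G(1) J(1), of _ "n - d"]) (simp add: K_def)
      moreover have "K \<in> F" by (rule shift_hereditaryD[OF F(1) I(1), of _ 0]) (simp add: K_def)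
      moreover have "card (P d) \<le> card K"
      proof (rule card_inj_on_le[of fst])
        show "inj_on fst (P d)" by (auto simp: inj_on_def P_def)
        have "i + (n - d) = j" if "i + n = j + d" for i j
          using that False by linarith
        then show "fst ` P d \<subseteq> K" by (auto simp: K_def P_def)
      qed (use fin in \<open>simp add: K_def\<close>)
      ultimately show ?thesis using I(2) by (intro bexI[of _ K]) (auto simp: K_def)
    qed
    then obtain K where K: "K \<in> F \<inter> G" "K \<subseteq> {..<n}" "card (P d) \<le> card K" by blast
    \<comment> \<open>Dividing by the \<open>2 * n\<close> possible differences produces the density
      \<open>c * e / 2\<close>.\<close>
    have "(c * real n) * (e * real n) \<le> real (card I) * real (card J)"
      using I(3) J(3) c(1) e(1) by (intro mult_mono) auto
    also have "\<dots> \<le> real (2 * n * card (P d))"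
      using d by (metis of_nat_le_iff of_nat_mult)
    also have "\<dots> \<le> 2 * real n * real (card K)"
      using K(3) by (simp add: mult_left_mono)
    finally have "c * e / 2 * real n \<le> real (card K)"
      using n by (simp add: field_simps)
    with K show ?thesis by blast
  qed
  with c(1) e(1) show ?thesis
    unfolding positive_density_def by (intro exI[of _ "c * e / 2"]) simp
qed

lemma positive_density_INT:
  assumes "finite I" and "\<And>l. l \<in> I \<Longrightarrow> shift_hereditary (F l)"
    and "\<And>l. l \<in> I \<Longrightarrow> positive_density (F l)"
  shows "positive_density (\<Inter>l\<in>I. F l)"
  using assms
proof (induction I rule: finite_induct)
  case empty
  \<comment> \<open>The empty intersection contains every set, in particular the whole
    window.\<close>
  have "\<forall>n>0. \<exists>J\<in>UNIV. J \<subseteq> {..<n} \<and> 1 * real n \<le> real (card J)"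
  proof (intro allI impI)
    fix n :: nat
    show "\<exists>J\<in>UNIV. J \<subseteq> {..<n} \<and> 1 * real n \<le> real (card J)"
      by (intro bexI[of _ "{..<n}"]) auto
  qed
  then show ?case
    unfolding positive_density_def by (intro exI[of _ 1]) auto
next
  case (insert l I)
  have "shift_hereditary (\<Inter>l\<in>I. F l)"
    using insert.prems(1) unfolding shift_hereditary_def by blast
  then have "positive_density (F l \<inter> (\<Inter>l\<in>I. F l))"
    using insert by (intro positive_density_Int) auto
  then show ?case by simp
qed

section \<open>Independence from uniformly positive entropy\<close>

lemma range_bool_eq: "range (W :: bool \<Rightarrow> 'c) = {W True, W False}"
  by (auto simp: UNIV_bool)

text \<open>The complements of small disjoint closed balls about the two points form a standard
  cover; independence sets of the balls are also independence sets of the larger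
  \<open>W b\<close>.\<close>

lemma UPE_positive_density_disjoint:
  fixes T :: "'a::metric_space \<Rightarrow> 'a"
  assumes "UPE euclidean T" "\<And>b. open (W b)" and xW: "\<And>b. x b \<in> W b" and neq: "x True \<noteq> x False"
  shows "positive_density (independence_sets T UNIV W)"
proof -
  obtain q where q: "\<And>b. q b > 0" "\<And>b. cball (x b) (q b) \<subseteq> W b"
  proof -
    have "\<exists>q>0. cball (x b) q \<subseteq> W b" for b
      using assms(2)[of b] xW[of b] open_contains_cball by blast
    then show ?thesis using that by metis
  qed
  \<comment> \<open>A third of the distance keeps the closed balls disjoint.\<close>
  define r where "r = Min {q True, q False, dist (x True) (x False) / 3}"
  have r: "r > 0" "r \<le> q True" "r \<le> q False" "r \<le> dist (x True) (x False) / 3"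
    using q(1) neq by (auto simp: r_def)
  define V where "V b = - cball (x b) r" for b
  have rq: "r \<le> q b" for b using r by (cases b) auto
  have VW: "- V b \<subseteq> W b" for b
    using q(2)[of b] rq[of b] by (auto simp: V_def)
  have cover: "V True \<union> V False = UNIV"
  proof -
    have "cball (x True) r \<inter> cball (x False) r = {}"
    proof (rule ccontr)
      assume "cball (x True) r \<inter> cball (x False) r \<noteq> {}"
      then obtain z where "dist (x True) z \<le> r" "dist (x False) z \<le> r" by auto
      moreover have "dist (x True) (x False) \<le> dist (x True) z + dist (x False) z"
        by (metis dist_commute dist_triangle)
      moreover have "dist (x True) (x False) > 0" using neq by simp
      ultimately show False using r(1,4) by linarith
    qed
    then show ?thesis by (auto simp: V_def)
  qed
  have dense: "closure (V b) \<noteq> UNIV" for b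
  proof -
    have "x b \<in> interior (cball (x b) r)"
      using r(1) by (intro interiorI[of "ball (x b) r"]) auto
    then show ?thesis by (auto simp: V_def closure_complement)
  qed
  have "standard_cover euclidean (range V)"
    unfolding standard_cover_def open_cover_def range_bool_eq
    using cover dense by (intro exI[of _ "V True"] exI[of _ "V False"]) (auto simp: V_def)
  with assms(1) have "cover_entropy euclidean T (range V) > 0"
    by (auto simp: UPE_def)
  then have "positive_density (independence_sets T (topspace euclidean) (\<lambda>b. topspace euclidean - V b))"
    using cover by (intro positive_density_if_entropy_pos) auto
  then have "positive_density (independence_sets T UNIV (\<lambda>b. - V b))"
    by (simp add: Compl_eq_Diff_UNIV)
  then show ?thesis
    by (rule positive_density_mono) (rule independence_sets_mono[OF VW])
qed

text \<open>The previous lemma needs distinct points; the remaining case is that both sets are the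
  same single point.\<close>

lemma UPE_positive_density:
  fixes T :: "'a::metric_space \<Rightarrow> 'a"
  assumes T: "UPE euclidean T" and W: "\<And>b. open (W b)" "\<And>b. W b \<noteq> {}"
  shows "positive_density (independence_sets T UNIV W)"
proof (cases "\<exists>x y. x \<in> W True \<and> y \<in> W False \<and> x \<noteq> y")
  case True
  then obtain x y where "x \<in> W True" "y \<in> W False" "x \<noteq> y" by blast
  then show ?thesis
    using W by (intro UPE_positive_density_disjoint[OF T, of _ "\<lambda>b. if b then x else y"]) auto
next
  case False
  then obtain p where p: "\<And>b. W b = {p}"
    using W(2)[of True] W(2)[of False] by (metis (full_types) all_not_in_conv insertI1 singletonD subsetI subset_antisym)
  show ?thesis
  proof (cases "\<exists>y. y \<noteq> p")
    case True
    then obtain y where y: "y \<noteq> p" by blast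
    \<comment> \<open>\<open>p\<close> is isolated, so \<open>{p}\<close> and \<open>- {p}\<close>
      are an admissible pair; its constant pattern \<open>True\<close> gives an orbit that is at
      \<open>p\<close> throughout \<open>J\<close>, which serves every pattern for
      \<open>W\<close>.\<close>
    define W' where "W' b = (if b then {p} else - {p})" for b
    have "open {p}" using W(1)[of True] p by simp
    then have "positive_density (independence_sets T UNIV W')"
      using y by (intro UPE_positive_density_disjoint[OF T, of _ "\<lambda>b. if b then p else y"])
        (auto simp: W'_def)
    moreover have "independence_sets T UNIV W' \<subseteq> independence_sets T UNIV W"
    proof
      fix J assume "J \<in> independence_sets T UNIV W'"
      then obtain z where "\<forall>j\<in>J. (T ^^ j) z \<in> W' True"
        unfolding mem_independence_sets_iff by (auto dest: spec[of _ "\<lambda>_. True"])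
      then show "J \<in> independence_sets T UNIV W"
        unfolding mem_independence_sets_iff by (auto simp: p W'_def)
    qed
    ultimately show ?thesis by (rule positive_density_mono)
  next
    case False
    then have "independence_sets T UNIV W = UNIV"
      by (auto simp: mem_independence_sets_iff p)
    then show ?thesis
      using positive_density_INT[of "{}"] by simp
  qed
qed

section \<open>Empirical measures and the weak-star topology\<close>

text \<open>Induction on the generation of the topology from its subbase: an intersection takes the
  union of the test functions and the smaller tolerance.\<close>

lemma weak_star_neighbourhood:
  fixes \<mu> :: "'a::topological_space measure"
  assumes "openin weak_star_topology G" "\<mu> \<in> G"
  obtains F :: "('a \<Rightarrow> real) set" and e :: real where
    "finite F" "\<And>f. f \<in> F \<Longrightarrow> continuous_on UNIV f" "e > 0"
    "\<And>\<nu>. \<nu> \<in> space (prob_algebra borel) \<Longrightarrow>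
       (\<And>f. f \<in> F \<Longrightarrow> \<bar>(\<integral>x. f x \<partial>\<nu>) - (\<integral>x. f x \<partial>\<mu>)\<bar> < e) \<Longrightarrow> \<nu> \<in> G"
proof -
  let ?B = "{{\<mu> \<in> space (prob_algebra borel). (\<integral>x. f x \<partial>\<mu>) \<in> W} | (f :: 'a \<Rightarrow> real) W.
        continuous_on UNIV f \<and> open W}"
  define P where "P G \<mu> F e \<longleftrightarrow> finite F \<and> (\<forall>f\<in>F. continuous_on UNIV f) \<and> e > 0 \<and>
    (\<forall>\<nu>\<in>space (prob_algebra borel).
       (\<forall>f\<in>F. \<bar>(\<integral>x. f x \<partial>\<nu>) - (\<integral>x. f x \<partial>\<mu>)\<bar> < e) \<longrightarrow> \<nu> \<in> G)"
    for G :: "'a measure set" and \<mu> and F :: "('a \<Rightarrow> real) set" and e :: real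
  have "generate_topology_on ?B G"
    using assms(1) unfolding weak_star_topology_def
    by (rule openin_topology_generated_by)
  then have "\<forall>\<mu>\<in>G. \<exists>F e. P G \<mu> F e"
  proof induction
    case Empty
    then show ?case by simp
  next
    case (Int A B)
    show ?case
    proof
      fix \<mu> assume \<mu>: "\<mu> \<in> A \<inter> B"
      obtain F e where "P A \<mu> F e" using Int.IH \<mu> by blast
      moreover obtain F' e' where "P B \<mu> F' e'" using Int.IH \<mu> by blast
      ultimately have "P (A \<inter> B) \<mu> (F \<union> F') (min e e')"
        by (simp add: P_def ball_Un)
      then show "\<exists>F e. P (A \<inter> B) \<mu> F e" by blast
    qed
  next
    case (UN K)
    show ?case
    proof
      fix \<mu> assume "\<mu> \<in> \<Union>K"
      then obtain A where A: "A \<in> K" "\<mu> \<in> A" by blast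
      then obtain F e where "P A \<mu> F e" using UN.IH by blast
      then have "P (\<Union>K) \<mu> F e" using A(1) unfolding P_def by blast
      then show "\<exists>F e. P (\<Union>K) \<mu> F e" by blast
    qed
  next
    case (Basis A)
    then obtain f :: "'a \<Rightarrow> real" and W where
      A: "A = {\<mu> \<in> space (prob_algebra borel). (\<integral>x. f x \<partial>\<mu>) \<in> W}" "continuous_on UNIV f" "open W"
      by blast
    show ?case
    proof
      fix \<mu> assume "\<mu> \<in> A"
      then have "(\<integral>x. f x \<partial>\<mu>) \<in> W" using A(1) by simp
      then obtain e where "e > 0" "\<And>t. dist t (\<integral>x. f x \<partial>\<mu>) < e \<Longrightarrow> t \<in> W"
        using A(3) unfolding open_dist by blast
      then have "P A \<mu> {f} e"
        using A(2) by (simp add: P_def A(1) dist_real_def)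
      then show "\<exists>F e. P A \<mu> F e" by blast
    qed
  qed
  with assms(2) obtain F e where "P G \<mu> F e" by blast
  then show thesis by (intro that[of F e]) (simp_all add: P_def)
qed

lemma measures_of_order_subset: "measures_of_order n \<subseteq> space (prob_algebra borel)"
  by (auto simp: measures_of_order_def split: enat.splits)

lemma measures_of_orderD:
  assumes "\<mu> \<in> measures_of_order n"
  shows "sets \<mu> = sets borel" "prob_space \<mu>"
  using assms measures_of_order_subset[of n] by (auto simp: space_prob_algebra)

lemma topspace_measure_space_of_order: "topspace (measure_space_of_order n) = measures_of_order n"
  using measures_of_order_subset[of n]
  by (auto simp: measure_space_of_order_def topspace_weak_star_topology space_prob_algebra)

lemma openin_integral_vimage:
  fixes f :: "'a::topological_space \<Rightarrow> real"
  assumes "continuous_on UNIV f" "open W"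
  shows "openin (measure_space_of_order n) {\<mu> \<in> measures_of_order n. (\<integral>x. f x \<partial>\<mu>) \<in> W}"
proof -
  have "openin weak_star_topology {\<mu> \<in> space (prob_algebra borel). (\<integral>x. f x \<partial>\<mu>) \<in> W}"
    unfolding weak_star_topology_def using assms by (intro topology_generated_by_Basis) blast
  then have "openin (measure_space_of_order n)
      ({\<mu> \<in> space (prob_algebra borel). (\<integral>x. f x \<partial>\<mu>) \<in> W} \<inter> measures_of_order n)"
    unfolding measure_space_of_order_def by (rule openin_subtopology_Int)
  also have "{\<mu> \<in> space (prob_algebra borel). (\<integral>x. f x \<partial>\<mu>) \<in> W} \<inter> measures_of_order n
      = {\<mu> \<in> measures_of_order n. (\<integral>x. f x \<partial>\<mu>) \<in> W}"
    using measures_of_order_subset[of n] by auto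
  finally show ?thesis .
qed

section \<open>Empirical measures\<close>

text \<open>For \<open>k > 0\<close>, the average of the unit masses at \<open>x 1\<close>, ...,
  \<open>x k\<close>, written as the law of \<open>x\<close> at a uniformly random index: image
  measures then amount to composition with \<open>x\<close>.\<close>

definition empirical_measure :: "nat \<Rightarrow> (nat \<Rightarrow> 'a) \<Rightarrow> 'a::topological_space measure" where
  "empirical_measure k x = distr (measure_pmf (pmf_of_set {1..k})) borel x"

lemma empirical_measure_in_prob_algebra: "empirical_measure k x \<in> space (prob_algebra borel)"
  unfolding empirical_measure_def space_prob_algebra
  by (auto intro: prob_space.prob_space_distr measure_pmf.prob_space_axioms)

lemma integral_empirical_measure:
  fixes f :: "'a::topological_space \<Rightarrow> real"
  assumes "k > 0" "f \<in> borel_measurable borel"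
  shows "(\<integral>y. f y \<partial>empirical_measure k x) = (\<Sum>i=1..k. f (x i)) / real k"
  unfolding empirical_measure_def
  using assms by (subst integral_distr) (auto simp: integral_pmf_of_set)

lemma measure_empirical_measure:
  assumes "k > 0" "A \<in> sets borel"
  shows "measure (empirical_measure k x) A
    = (1 / real k) * (\<Sum>i=1..k. measure (return borel (x i)) A)"
proof -
  have "measure (empirical_measure k x) A = (\<integral>y. indicator A y \<partial>empirical_measure k x)"
    using assms by (simp add: empirical_measure_def)
  also have "\<dots> = (\<Sum>i=1..k. indicator A (x i)) / real k"
    using assms by (intro integral_empirical_measure) auto
  finally show ?thesis
    using assms(2) by (simp add: measure_return)
qed

lemma measures_of_order_enat:
  assumes "k > 0"
  shows "measures_of_order (enat k) = range (empirical_measure k)"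
proof (intro equalityI subsetI)
  fix \<mu> :: "'a measure" assume "\<mu> \<in> measures_of_order (enat k)"
  then obtain x where \<mu>: "sets \<mu> = sets borel" "prob_space \<mu>"
    and x: "\<And>A. A \<in> sets borel \<Longrightarrow>
       measure \<mu> A = (1 / real k) * (\<Sum>i=1..k. measure (return borel (x i)) A)"
    by (auto simp: measures_of_order_def space_prob_algebra)
  interpret prob_space \<mu> by fact
  interpret E: prob_space "empirical_measure k x"
    using empirical_measure_in_prob_algebra[of k x] by (simp add: space_prob_algebra)
  have "\<mu> = empirical_measure k x"
  proof (rule measure_eqI)
    fix A assume "A \<in> sets \<mu>"
    then show "emeasure \<mu> A = emeasure (empirical_measure k x) A"
      using \<mu>(1) assms by (simp add: emeasure_eq_measure E.emeasure_eq_measure x measure_empirical_measure)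
  qed (simp add: \<mu> empirical_measure_def)
  then show "\<mu> \<in> range (empirical_measure k)" by blast
next
  fix \<mu> :: "'a measure" assume "\<mu> \<in> range (empirical_measure k)"
  then obtain x where "\<mu> = empirical_measure k x" by blast
  moreover have "\<forall>A\<in>sets borel. measure (empirical_measure k x) A
      = (1 / real k) * (\<Sum>i=1..k. measure (return borel (x i)) A)"
    using measure_empirical_measure[OF assms] by blast
  ultimately show "\<mu> \<in> measures_of_order (enat k)"
    using empirical_measure_in_prob_algebra[of k x] unfolding measures_of_order_def enat.case
    by blast
qed

section \<open>Iterates of the induced map\<close>

lemma continuous_on_funpow:
  fixes T :: "'a::topological_space \<Rightarrow> 'a"
  assumes "continuous_on UNIV T"
  shows "continuous_on UNIV (T ^^ j)"
  by (induction j) (auto intro: continuous_on_compose2[OF assms] simp: continuous_on_id' id_def comp_def)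

lemma induced_map_funpow:
  fixes T :: "'a::topological_space \<Rightarrow> 'a"
  assumes "continuous_on UNIV T" "sets \<mu> = sets borel"
  shows "(induced_map T ^^ j) \<mu> = distr \<mu> borel (T ^^ j)"
proof (induction j)
  case 0
  show ?case using assms(2) by (simp add: distr_id2 id_def)
next
  case (Suc j)
  have T: "T \<in> borel_measurable borel" "T ^^ j \<in> measurable \<mu> borel"
    using continuous_on_funpow[OF assms(1), of j] assms
    by (auto intro!: borel_measurable_continuous_onI cong: measurable_cong_sets)
  show ?case
    by (simp add: Suc) (simp add: induced_map_def distr_distr[OF T] comp_def)
qed

lemma integral_induced_map_funpow:
  fixes f :: "'a::topological_space \<Rightarrow> real"
  assumes "continuous_on UNIV T" "sets \<mu> = sets borel" "continuous_on UNIV f"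
  shows "(\<integral>y. f y \<partial>(induced_map T ^^ j) \<mu>) = (\<integral>y. f ((T ^^ j) y) \<partial>\<mu>)"
  unfolding induced_map_funpow[OF assms(1,2)]
  using continuous_on_funpow[OF assms(1), of j] assms
  by (intro integral_distr)
    (auto intro!: borel_measurable_continuous_onI cong: measurable_cong_sets)

lemma induced_map_funpow_empirical_measure:
  fixes T :: "'a::topological_space \<Rightarrow> 'a"
  assumes "continuous_on UNIV T"
  shows "(induced_map T ^^ j) (empirical_measure k x) = empirical_measure k (T ^^ j \<circ> x)"
proof -
  have "sets (empirical_measure k x) = sets borel" by (simp add: empirical_measure_def)
  moreover have "T ^^ j \<in> borel_measurable borel"
    using continuous_on_funpow[OF assms] by (rule borel_measurable_continuous_onI)
  ultimately show ?thesis
    by (simp add: induced_map_funpow[OF assms] empirical_measure_def distr_distr)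
qed

lemma induced_map_in_measures_of_order:
  fixes T :: "'a::topological_space \<Rightarrow> 'a"
  assumes "continuous_on UNIV T" "1 \<le> n"
  shows "induced_map T \<in> measures_of_order n \<rightarrow> measures_of_order n"
proof
  fix \<mu> :: "'a measure" assume \<mu>: "\<mu> \<in> measures_of_order n"
  show "induced_map T \<mu> \<in> measures_of_order n"
  proof (cases n)
    case (enat k)
    with assms(2) have "k > 0" by (simp add: one_enat_def)
    with \<mu> enat obtain x where "\<mu> = empirical_measure k x"
      by (auto simp: measures_of_order_enat)
    with \<open>k > 0\<close> enat show ?thesis
      using induced_map_funpow_empirical_measure[OF assms(1), of 1 k x]
      by (auto simp: measures_of_order_enat)
  next
    case infinity
    have "T \<in> measurable \<mu> borel"
      using assms(1) measures_of_orderD(1)[OF \<mu>]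
      by (auto intro!: borel_measurable_continuous_onI cong: measurable_cong_sets)
    then have "prob_space (induced_map T \<mu>)"
      unfolding induced_map_def by (intro prob_space.prob_space_distr measures_of_orderD(2)[OF \<mu>])
    then show ?thesis
      by (simp add: infinity measures_of_order_def space_prob_algebra induced_map_def)
  qed
qed

lemma empirical_measure_in_measures_of_order:
  assumes "1 \<le> n"
  obtains k where "k > 0" "\<And>x. empirical_measure k x \<in> measures_of_order n"
proof (cases n)
  case (enat k)
  with assms have "k > 0" by (simp add: one_enat_def)
  with enat show thesis by (intro that[of k]) (auto simp: measures_of_order_enat)
next
  case infinity
  then show thesis
    using empirical_measure_in_prob_algebra by (intro that[of 1]) (auto simp: measures_of_order_def)
qed

section \<open>Approximation by empirical measures\<close>

lemma integrable_continuous_compact: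
  fixes f :: "'a::topological_space \<Rightarrow> real"
  assumes "compact (UNIV :: 'a set)" "continuous_on UNIV f" "sets \<mu> = sets borel" "prob_space \<mu>"
  shows "integrable \<mu> f"
proof -
  interpret prob_space \<mu> by fact
  obtain B where B: "\<And>x. norm (f x) \<le> B"
    using compact_imp_bounded[OF compact_continuous_image[OF assms(2,1)]]
    by (auto simp: bounded_iff)
  have "f \<in> borel_measurable \<mu>"
    using assms(2,3) by (auto intro!: borel_measurable_continuous_onI cong: measurable_cong_sets)
  with B show ?thesis
    by (intro integrable_const_bound[of _ B]) auto
qed

lemma (in prob_space) exists_le_expectation:
  fixes h :: "'a \<Rightarrow> real"
  assumes "integrable M h"
  obtains y where "y \<in> space M" "h y \<le> expectation h"
proof (rule ccontr)
  assume "\<not> thesis"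
  with that have "AE y in M. expectation h < h y"
    by (intro AE_I2) (meson not_le)
  with assms have "expectation h < expectation h"
    by (rule expectation_greater)
  then show False by simp
qed

text \<open>The points are chosen greedily: averaging over the next point shows that the sum of squared
  deviations can be kept below its expected value for independent samples, which is linear in
  the number of points.\<close>

lemma empirical_measure_approximation:
  fixes F :: "('a::topological_space \<Rightarrow> real) set"
  assumes X: "compact (UNIV :: 'a set)" and \<mu>: "sets \<mu> = sets borel" "prob_space \<mu>"
    and F: "finite F" "\<And>f. f \<in> F \<Longrightarrow> continuous_on UNIV f" and "e > 0"
  obtains K :: nat where "\<And>k. k \<ge> K \<Longrightarrow>
    \<exists>x. \<forall>f\<in>F. \<bar>(\<integral>y. f y \<partial>empirical_measure k x) - (\<integral>y. f y \<partial>\<mu>)\<bar> < e"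
proof -
  interpret prob_space \<mu> by fact
  define g where "g f y = f y - (\<integral>y. f y \<partial>\<mu>)" for f :: "'a \<Rightarrow> real" and y
  \<comment> \<open>Total variance: \<open>real k * C\<close> is the expected sum of squares for
    \<open>k\<close> independent samples.\<close>
  define C where "C = (\<Sum>f\<in>F. \<integral>y. (g f y)\<^sup>2 \<partial>\<mu>)"
  have cont: "continuous_on UNIV (g f)" if "f \<in> F" for f
    unfolding g_def using F(2)[OF that] by (intro continuous_intros)
  have int: "integrable \<mu> f" if "continuous_on UNIV f" for f :: "'a \<Rightarrow> real"
    by (rule integrable_continuous_compact[OF X that \<mu>])
  have g0: "(\<integral>y. g f y \<partial>\<mu>) = 0" if "f \<in> F" for f
    unfolding g_def using int[OF F(2)[OF that]] by (simp add: prob_space)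
  have sample: "\<exists>x. (\<Sum>f\<in>F. (\<Sum>i=1..k. g f (x i))\<^sup>2) \<le> real k * C" for k
  proof (induction k)
    case 0
    then show ?case by simp
  next
    case (Suc k)
    then obtain x where x: "(\<Sum>f\<in>F. (\<Sum>i=1..k. g f (x i))\<^sup>2) \<le> real k * C" by blast
    define s where "s f = (\<Sum>i=1..k. g f (x i))" for f
    have int2: "integrable \<mu> (\<lambda>y. (s f + g f y)\<^sup>2)" if "f \<in> F" for f
      using cont[OF that] by (intro int continuous_intros)
    \<comment> \<open>The cross term vanishes because \<open>g f\<close> is centred.\<close>
    have eq: "(\<integral>y. (s f + g f y)\<^sup>2 \<partial>\<mu>) = (s f)\<^sup>2 + (\<integral>y. (g f y)\<^sup>2 \<partial>\<mu>)" if "f \<in> F" for f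
    proof -
      have "(\<integral>y. (s f + g f y)\<^sup>2 \<partial>\<mu>) = (\<integral>y. (s f)\<^sup>2 + 2 * s f * g f y + (g f y)\<^sup>2 \<partial>\<mu>)"
        by (simp add: power2_sum algebra_simps)
      also have "\<dots> = (s f)\<^sup>2 + 2 * s f * (\<integral>y. g f y \<partial>\<mu>) + (\<integral>y. (g f y)\<^sup>2 \<partial>\<mu>)"
        using int[OF cont[OF that]] int[of "\<lambda>y. (g f y)\<^sup>2"] cont[OF that]
        by (simp add: prob_space continuous_on_power)
      finally show ?thesis by (simp add: g0[OF that])
    qed
    have "integrable \<mu> (\<lambda>y. \<Sum>f\<in>F. (s f + g f y)\<^sup>2)"
      by (intro Bochner_Integration.integrable_sum int2)
    then obtain y where "(\<Sum>f\<in>F. (s f + g f y)\<^sup>2) \<le> (\<integral>y. (\<Sum>f\<in>F. (s f + g f y)\<^sup>2) \<partial>\<mu>)"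
      by (rule exists_le_expectation)
    also have "\<dots> = (\<Sum>f\<in>F. (s f)\<^sup>2 + (\<integral>y. (g f y)\<^sup>2 \<partial>\<mu>))"
      using int2 by (simp add: Bochner_Integration.integral_sum eq)
    also have "\<dots> \<le> real (Suc k) * C"
      using x by (simp add: sum.distrib C_def s_def algebra_simps)
    finally have "(\<Sum>f\<in>F. (\<Sum>i=1..Suc k. g f ((x(Suc k := y)) i))\<^sup>2) \<le> real (Suc k) * C"
      by (simp add: s_def)
    then show ?case by blast
  qed
  \<comment> \<open>Chebyshev's threshold: beyond it \<open>real k * C\<close> is below
    \<open>(real k * e)\<^sup>2\<close>.\<close>
  obtain K :: nat where K: "real K > C / e\<^sup>2" using reals_Archimedean2 by blast
  show thesis
  proof (rule that[of "Suc K"])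
    fix k assume k: "k \<ge> Suc K"
    obtain x where x: "(\<Sum>f\<in>F. (\<Sum>i=1..k. g f (x i))\<^sup>2) \<le> real k * C" using sample by blast
    have "\<bar>(\<integral>y. f y \<partial>empirical_measure k x) - (\<integral>y. f y \<partial>\<mu>)\<bar> < e" if f: "f \<in> F" for f
    proof -
      have "(\<Sum>i=1..k. g f (x i))\<^sup>2 \<le> (\<Sum>f\<in>F. (\<Sum>i=1..k. g f (x i))\<^sup>2)"
        using F(1) f by (intro member_le_sum) auto
      also have "\<dots> \<le> real k * C" by (rule x)
      also have "\<dots> < real k * (real k * e\<^sup>2)"
      proof -
        have "C / e\<^sup>2 < real k" using K k by linarith
        then show ?thesis using \<open>e > 0\<close> k by (simp add: field_simps)
      qed
      also have "\<dots> = (real k * e)\<^sup>2"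
        by (simp add: power2_eq_square mult_ac)
      finally have "\<bar>\<Sum>i=1..k. g f (x i)\<bar>\<^sup>2 < (real k * e)\<^sup>2"
        by (simp only: power2_abs)
      then have bound: "\<bar>\<Sum>i=1..k. g f (x i)\<bar> < real k * e"
        by (rule power2_less_imp_less) (use \<open>e > 0\<close> in simp)
      have "(\<Sum>i=1..k. g f (x i)) = (\<Sum>i=1..k. f (x i)) - real k * (\<integral>y. f y \<partial>\<mu>)"
        by (simp add: g_def sum_subtractf)
      moreover have "(\<integral>y. f y \<partial>empirical_measure k x) = (\<Sum>i=1..k. f (x i)) / real k"
        using k F(2)[OF f] by (intro integral_empirical_measure borel_measurable_continuous_onI) auto
      ultimately have "(\<integral>y. f y \<partial>empirical_measure k x) - (\<integral>y. f y \<partial>\<mu>)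
          = (\<Sum>i=1..k. g f (x i)) / real k"
        using k by (simp add: diff_divide_distrib)
      moreover have "\<bar>(\<Sum>i=1..k. g f (x i)) / real k\<bar> < e"
        using bound k by (simp add: abs_divide pos_divide_less_eq mult.commute)
      ultimately show ?thesis by simp
    qed
    then show "\<exists>x. \<forall>f\<in>F. \<bar>(\<integral>y. f y \<partial>empirical_measure k x) - (\<integral>y. f y \<partial>\<mu>)\<bar> < e" by blast
  qed
qed

section \<open>Transfer between the base and the space of measures\<close>

text \<open>Independence without errors is a special case of almost independence, for whatever
  \<open>\<eta>\<close> the tail bound supplies.\<close>

lemma entropy_pos_if_positive_density:
  assumes S: "S \<in> topspace Y \<rightarrow> topspace Y" and W: "W True \<union> W False = topspace Y"
    and dens: "positive_density (independence_sets S (topspace Y) (\<lambda>b. topspace Y - W b))"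
  shows "cover_entropy Y S (range W) > 0"
proof -
  obtain \<eta> :: real where \<eta>: "\<eta> > 0"
    "\<And>n k. real k \<le> \<eta> * real n \<Longrightarrow> (\<Sum>i\<le>k. real (n choose i)) \<le> 2 powr (1 / 2 * real n)"
    using binomial_tail_exponential[of "1 / 2"] by auto
  obtain c where c: "c > 0" "\<And>n. n > 0 \<Longrightarrow>
      \<exists>J\<in>independence_sets S (topspace Y) (\<lambda>b. topspace Y - W b).
        J \<subseteq> {..<n} \<and> c * real n \<le> real (card J)"
    using dens unfolding positive_density_def by blast
  show ?thesis
  proof (rule entropy_pos_if_almost_independent[OF S W _ \<eta>(1) c(1)])
    fix n :: nat assume "n > 0"
    then obtain J where J: "J \<in> independence_sets S (topspace Y) (\<lambda>b. topspace Y - W b)"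
        "J \<subseteq> {..<n}" "c * real n \<le> real (card J)"
      using c(2) by blast
    have "\<exists>y\<in>topspace Y. (1 - \<eta>) * real (card J) \<le> real (card {j \<in> J. (S ^^ j) y \<notin> W (\<sigma> j)})" for \<sigma>
    proof -
      obtain y where y: "y \<in> topspace Y" "\<forall>j\<in>J. (S ^^ j) y \<in> topspace Y - W (\<sigma> j)"
        using J(1) unfolding mem_independence_sets_iff by blast
      then have "{j \<in> J. (S ^^ j) y \<notin> W (\<sigma> j)} = J" by blast
      moreover have "(1 - \<eta>) * real (card J) \<le> 1 * real (card J)"
        using \<eta>(1) by (intro mult_right_mono) auto
      ultimately show ?thesis using y(1) by (intro bexI[of _ y]) auto
    qed
    with J(2,3) show "\<exists>J\<subseteq>{..<n}. c * real n \<le> real (card J) \<and> (\<forall>\<sigma>. \<exists>y\<in>topspace Y.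
        (1 - \<eta>) * real (card J) \<le> real (card {j \<in> J. (S ^^ j) y \<notin> W (\<sigma> j)}))"
      by blast
  qed (use \<eta>(2) in simp)
qed

text \<open>Both measures need the same number of atoms, so that each atom can later switch between
  its two neighbourhoods. For \<open>n = \<infinity>\<close> approximation works for every large
  number of atoms, and the larger threshold serves both sets.\<close>

lemma empirical_measures_in_open_sets:
  fixes O' :: "bool \<Rightarrow> 'a::topological_space measure set"
  assumes X: "compact (UNIV :: 'a set)" and n: "1 \<le> n"
    and O': "\<And>b. openin (measure_space_of_order n) (O' b)" "\<And>b. O' b \<noteq> {}"
  obtains k and x :: "bool \<Rightarrow> nat \<Rightarrow> 'a" where "k > 0"
    "\<And>y :: nat \<Rightarrow> 'a. empirical_measure k y \<in> measures_of_order n" "\<And>b. empirical_measure k (x b) \<in> O' b"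
proof -
  have sub: "O' b \<subseteq> measures_of_order n" for b
    using openin_subset[OF O'(1)[of b]] by (simp add: topspace_measure_space_of_order)
  show thesis
  proof (cases n)
    case (enat k)
    with n have k: "k > 0" by (simp add: one_enat_def)
    have "\<exists>y. empirical_measure k y \<in> O' b" for b
      using O'(2)[of b] sub[of b] k enat by (fastforce simp: measures_of_order_enat)
    then obtain x where "\<And>b. empirical_measure k (x b) \<in> O' b" by metis
    with k enat show thesis by (intro that[of k x]) (auto simp: measures_of_order_enat)
  next
    case infinity
    then have M: "measures_of_order n = (space (prob_algebra borel) :: 'a measure set)"
      by (simp add: measures_of_order_def)
    have "\<exists>K. \<forall>k\<ge>K. \<exists>x. empirical_measure k x \<in> O' b" for b
    proof -
      obtain G where G: "openin weak_star_topology G" "O' b = G \<inter> measures_of_order n"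
        using O'(1)[of b] unfolding measure_space_of_order_def openin_subtopology by blast
      obtain \<mu> where \<mu>: "\<mu> \<in> O' b" using O'(2)[of b] by blast
      with G have "\<mu> \<in> G" by blast
      obtain F :: "('a \<Rightarrow> real) set" and e where F: "finite F"
        "\<And>f. f \<in> F \<Longrightarrow> continuous_on UNIV f" "e > 0"
        "\<And>\<nu>. \<nu> \<in> space (prob_algebra borel) \<Longrightarrow>
           (\<And>f. f \<in> F \<Longrightarrow> \<bar>(\<integral>x. f x \<partial>\<nu>) - (\<integral>x. f x \<partial>\<mu>)\<bar> < e) \<Longrightarrow> \<nu> \<in> G"
        using weak_star_neighbourhood[OF G(1) \<open>\<mu> \<in> G\<close>] by blast
      have \<mu>': "sets \<mu> = sets borel" "prob_space \<mu>"
        using measures_of_orderD sub \<mu> by blast+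
      obtain K where K: "\<And>k. k \<ge> K \<Longrightarrow>
          \<exists>x. \<forall>f\<in>F. \<bar>(\<integral>y. f y \<partial>empirical_measure k x) - (\<integral>y. f y \<partial>\<mu>)\<bar> < e"
        using empirical_measure_approximation[OF X \<mu>' F(1-3)] by blast
      show ?thesis
      proof (intro exI[of _ K] allI impI)
        fix k assume "k \<ge> K"
        then obtain x where "\<forall>f\<in>F. \<bar>(\<integral>y. f y \<partial>empirical_measure k x) - (\<integral>y. f y \<partial>\<mu>)\<bar> < e"
          using K by blast
        then have "empirical_measure k x \<in> G"
          by (intro F(4) empirical_measure_in_prob_algebra) blast
        then show "\<exists>x. empirical_measure k x \<in> O' b"
          using G(2) M empirical_measure_in_prob_algebra by blast
      qed
    qed
    then obtain K where K: "\<And>b k. k \<ge> K b \<Longrightarrow> \<exists>x. empirical_measure k x \<in> O' b" by metis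
    define k where "k = Suc (max (K True) (K False))"
    have "k \<ge> K b" for b by (cases b) (auto simp: k_def)
    then have "\<exists>y. empirical_measure k y \<in> O' b" for b by (rule K)
    then obtain x where "\<And>b. empirical_measure k (x b) \<in> O' b" by metis
    then show thesis
      by (intro that[of k x]) (simp_all add: k_def M empirical_measure_in_prob_algebra)
  qed
qed

text \<open>By weak-star continuity, moving each atom of an empirical measure within a suitable
  neighbourhood keeps the measure in a given open set. The systems of neighbourhoods of the atoms
  have a common dense family of independence sets.\<close>

lemma positive_density_empirical_measures:
  fixes T :: "'a::metric_space \<Rightarrow> 'a" and O' :: "bool \<Rightarrow> 'a measure set"
  assumes X: "compact (UNIV :: 'a set)" and T: "continuous_on UNIV T" and UPE: "UPE euclidean T"
    and n: "1 \<le> n"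
    and O': "\<And>b. openin (measure_space_of_order n) (O' b)" "\<And>b. O' b \<noteq> {}"
  shows "positive_density (independence_sets (induced_map T) (measures_of_order n) O')"
proof -
  obtain k and x :: "bool \<Rightarrow> nat \<Rightarrow> 'a" where k: "k > 0"
    and emp: "\<And>y :: nat \<Rightarrow> 'a. empirical_measure k y \<in> measures_of_order n"
    and x: "\<And>b. empirical_measure k (x b) \<in> O' b"
    using empirical_measures_in_open_sets[of n O', OF X n O'] by blast
  have "\<exists>(F :: ('a \<Rightarrow> real) set) e. finite F \<and> (\<forall>f\<in>F. continuous_on UNIV f) \<and> e > 0 \<and>
      (\<forall>y. (\<forall>f\<in>F. \<bar>(\<integral>z. f z \<partial>empirical_measure k y) - (\<integral>z. f z \<partial>empirical_measure k (x b))\<bar> < e)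
         \<longrightarrow> empirical_measure k y \<in> O' b)" for b
  proof -
    obtain G where G: "openin weak_star_topology G" "O' b = G \<inter> measures_of_order n"
      using O'(1)[of b] unfolding measure_space_of_order_def openin_subtopology by blast
    with x have "empirical_measure k (x b) \<in> G" by blast
    from weak_star_neighbourhood[OF G(1) this] obtain F :: "('a \<Rightarrow> real) set" and e where
      F: "finite F" "\<And>f. f \<in> F \<Longrightarrow> continuous_on UNIV f" "e > 0"
        "\<And>\<nu>. \<nu> \<in> space (prob_algebra borel) \<Longrightarrow> (\<And>f. f \<in> F \<Longrightarrow>
           \<bar>(\<integral>z. f z \<partial>\<nu>) - (\<integral>z. f z \<partial>empirical_measure k (x b))\<bar> < e) \<Longrightarrow> \<nu> \<in> G"
      by blast
    show ?thesis
      by (rule exI[of _ F], rule exI[of _ e])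
        (use F G(2) emp in \<open>auto intro!: F(4) empirical_measure_in_prob_algebra\<close>)
  qed
  then obtain F :: "bool \<Rightarrow> ('a \<Rightarrow> real) set" and e where
    F: "\<And>b. finite (F b)" "\<And>b f. f \<in> F b \<Longrightarrow> continuous_on UNIV f" "\<And>b. e b > 0"
      "\<And>b y. (\<forall>f\<in>F b. \<bar>(\<integral>z. f z \<partial>empirical_measure k y)
          - (\<integral>z. f z \<partial>empirical_measure k (x b))\<bar> < e b) \<Longrightarrow> empirical_measure k y \<in> O' b"
    by metis
  define V where "V l b = (\<Inter>f\<in>F b. {y. \<bar>f y - f (x b l)\<bar> < e b})" for l b
  have V: "x b l \<in> V l b" "open (V l b)" for l b
  proof -
    show "x b l \<in> V l b" using F(3) by (simp add: V_def)
    show "open (V l b)"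
      unfolding V_def using F(1,2) by (intro open_INT ballI open_Collect_less continuous_intros) auto
  qed
  have VO: "empirical_measure k y \<in> O' b" if y: "\<And>l. l \<in> {1..k} \<Longrightarrow> y l \<in> V l b" for y b
  proof (rule F(4), rule ballI)
    fix f assume f: "f \<in> F b"
    then have meas: "f \<in> borel_measurable borel"
      by (intro borel_measurable_continuous_onI F(2))
    have "\<bar>\<Sum>l=1..k. f (y l) - f (x b l)\<bar> \<le> (\<Sum>l=1..k. \<bar>f (y l) - f (x b l)\<bar>)"
      by (rule sum_abs)
    \<comment> \<open>The average of \<open>k\<close> deviations below \<open>e b\<close> is below
      \<open>e b\<close>; strictness uses \<open>k > 0\<close>.\<close>
    also have "\<dots> < (\<Sum>l=1..k. e b)"
      using k y f by (intro sum_strict_mono) (auto simp: V_def)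
    finally have "\<bar>\<Sum>l=1..k. f (y l) - f (x b l)\<bar> / real k < e b"
      using k by (simp add: field_simps)
    then show "\<bar>(\<integral>z. f z \<partial>empirical_measure k y) - (\<integral>z. f z \<partial>empirical_measure k (x b))\<bar> < e b"
      using k by (simp add: integral_empirical_measure[OF k meas] sum_subtractf
          flip: diff_divide_distrib)
  qed
  have "positive_density (independence_sets T UNIV (V l))" for l
    by (rule UPE_positive_density[OF UPE]) (use V in blast)+
  then have "positive_density (\<Inter>l\<in>{1..k}. independence_sets T UNIV (V l))"
    by (intro positive_density_INT shift_hereditary_independence_sets) auto
  then show ?thesis
  proof (rule positive_density_mono, intro subsetI)
    fix J assume J: "J \<in> (\<Inter>l\<in>{1..k}. independence_sets T UNIV (V l))"
    show "J \<in> independence_sets (induced_map T) (measures_of_order n) O'"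
      unfolding mem_independence_sets_iff
    proof
      fix \<sigma>
      \<comment> \<open>All atoms follow the same pattern, each from its own starting point and
        through its own neighbourhoods.\<close>
      have "\<forall>l\<in>{1..k}. \<exists>y. \<forall>j\<in>J. (T ^^ j) y \<in> V l (\<sigma> j)"
        using J unfolding mem_independence_sets_iff INT_iff by blast
      then obtain y where y: "\<And>l j. l \<in> {1..k} \<Longrightarrow> j \<in> J \<Longrightarrow> (T ^^ j) (y l) \<in> V l (\<sigma> j)"
        by metis
      have "(induced_map T ^^ j) (empirical_measure k y) \<in> O' (\<sigma> j)" if "j \<in> J" for j
        unfolding induced_map_funpow_empirical_measure[OF T] using y that by (intro VO) auto
      then show "\<exists>\<mu>\<in>measures_of_order n. \<forall>j\<in>J. (induced_map T ^^ j) \<mu> \<in> O' (\<sigma> j)"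
        using emp by blast
    qed
  qed
qed

text \<open>Non-density gives both members of a standard cover non-empty open exteriors. Empirical
  measures supply independence sets for this pair, hence for the larger complements.\<close>

theorem UPE_induced_map:
  fixes T :: "'a::metric_space \<Rightarrow> 'a"
  assumes X: "compact (UNIV :: 'a set)" and T: "continuous_on UNIV T" and UPE: "UPE euclidean T"
    and n: "1 \<le> n"
  shows "UPE (measure_space_of_order n) (induced_map T)"
  unfolding UPE_def
proof (intro allI impI)
  let ?Y = "measure_space_of_order n :: 'a measure topology"
  fix \<U> :: "'a measure set set" assume "standard_cover ?Y \<U>"
  then obtain U V where UV: "\<U> = {U, V}" "open_cover ?Y {U, V}"
      "?Y closure_of U \<noteq> topspace ?Y" "?Y closure_of V \<noteq> topspace ?Y"
    unfolding standard_cover_def by blast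
  define W where "W b = (if b then U else V)" for b
  have W: "W True \<union> W False = topspace ?Y" "\<U> = range W" "\<And>b. W b \<subseteq> topspace ?Y"
      "\<And>b. ?Y closure_of W b \<noteq> topspace ?Y"
    using UV by (auto simp: W_def open_cover_def range_bool_eq)
  define O' where "O' b = topspace ?Y - ?Y closure_of W b" for b
  have "positive_density (independence_sets (induced_map T) (measures_of_order n) O')"
  proof (rule positive_density_empirical_measures[OF X T UPE n])
    show "openin ?Y (O' b)" for b
      unfolding O'_def by (intro openin_diff openin_topspace closedin_closure_of)
    show "O' b \<noteq> {}" for b
      using W(4)[of b] closure_of_subset_topspace[of ?Y "W b"] by (auto simp: O'_def)
  qed
  then have "positive_density (independence_sets (induced_map T) (topspace ?Y) (\<lambda>b. topspace ?Y - W b))"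
    unfolding topspace_measure_space_of_order[of n, symmetric]
  proof (rule positive_density_mono)
    show "independence_sets (induced_map T) (topspace ?Y) O'
        \<subseteq> independence_sets (induced_map T) (topspace ?Y) (\<lambda>b. topspace ?Y - W b)"
      using closure_of_subset[OF W(3)] by (intro independence_sets_mono) (auto simp: O'_def)
  qed
  then show "0 < cover_entropy ?Y (induced_map T) \<U>"
    unfolding W(2) using induced_map_in_measures_of_order[OF T n] W(1)
    by (intro entropy_pos_if_positive_density) (simp_all add: topspace_measure_space_of_order)
qed

text \<open>Bump functions at points outside the closures turn a cover of the base into one of the space
  of measures. A measure in the complement of the latter along the orbit yields a point whose orbit
  follows the same itinerary up to a small proportion of errors.\<close>

theorem UPE_if_UPE_induced_map:
  fixes T :: "'a::metric_space \<Rightarrow> 'a"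
  assumes X: "compact (UNIV :: 'a set)" and T: "continuous_on UNIV T" and n: "1 \<le> n"
    and UPE: "UPE (measure_space_of_order n) (induced_map T)"
  shows "UPE euclidean T"
  unfolding UPE_def
proof (intro allI impI)
  let ?Y = "measure_space_of_order n :: 'a measure topology"
  fix \<U> :: "'a set set" assume "standard_cover euclidean \<U>"
  then obtain U V where UV: "\<U> = {U, V}" "open_cover euclidean {U, V}"
      "closure U \<noteq> UNIV" "closure V \<noteq> UNIV"
    unfolding standard_cover_def by auto
  define W where "W b = (if b then U else V)" for b
  have W: "W True \<union> W False = UNIV" "\<U> = range W" "\<And>b. closure (W b) \<noteq> UNIV"
    using UV by (auto simp: W_def open_cover_def range_bool_eq)
  have "\<exists>x. x \<notin> closure (W b)" for b using W(3) by blast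
  then obtain x where "\<And>b. x b \<notin> closure (W b)" by metis
  then have "\<forall>b. \<exists>r>0. \<forall>y\<in>W b. r \<le> dist y (x b)"
    unfolding closure_approachable by (meson not_le)
  then obtain r where r: "\<And>b. r b > 0" "\<And>b y. y \<in> W b \<Longrightarrow> r b \<le> dist y (x b)" by metis
  \<comment> \<open>The bump is \<open>1\<close> at \<open>x b\<close> and vanishes on
    \<open>W b\<close>, which keeps distance \<open>r b\<close> from \<open>x b\<close>.\<close>
  define f where "f b y = max 0 (1 - dist y (x b) / r b)" for b y
  have f_cont: "continuous_on UNIV (f b)" for b
    unfolding f_def using r(1)[of b] by (intro continuous_intros) auto
  have f_range: "0 \<le> f b y" "f b y \<le> 1" for b y
    using r(1)[of b] by (auto simp: f_def)
  have f_zero: "f b y = 0" if "y \<in> W b" for b y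
    using r(1)[of b] r(2)[OF that] by (simp add: f_def)
  \<comment> \<open>Since the \<open>W b\<close> cover the space, at each point one of the two bumps
    vanishes.\<close>
  have f_sum: "f True y + f False y \<le> 1" for y
  proof -
    have "y \<in> W True \<or> y \<in> W False" using W(1) by blast
    then show ?thesis using f_zero f_range by force
  qed
  obtain \<eta>0 :: real where \<eta>0: "\<eta>0 > 0"
    "\<And>n k. real k \<le> \<eta>0 * real n \<Longrightarrow> (\<Sum>i\<le>k. real (n choose i)) \<le> 2 powr (1 / 2 * real n)"
    using binomial_tail_exponential[of "1 / 2"] by auto
  \<comment> \<open>The cap \<open>1 / 4\<close> prevents both integrals from reaching
    \<open>1 - \<eta>\<close>, since they sum to at most \<open>1\<close>; this makes the
    \<open>P b\<close> a cover.\<close>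
  define \<eta> where "\<eta> = min \<eta>0 (1 / 4)"
  have \<eta>: "\<eta> > 0" "\<eta> \<le> 1 / 4" using \<eta>0(1) by (auto simp: \<eta>_def)
  have tail: "(\<Sum>i\<le>k. real (n choose i)) \<le> 2 powr (real n / 2)" if "real k \<le> \<eta> * real n" for n k
  proof -
    have "\<eta> * real n \<le> \<eta>0 * real n" by (intro mult_right_mono) (auto simp: \<eta>_def)
    with that \<eta>0(2)[of k n] show ?thesis by simp
  qed
  define P where "P b = {\<mu> \<in> measures_of_order n. (\<integral>y. f b y \<partial>\<mu>) \<in> {..<1 - \<eta>}}" for b
  \<comment> \<open>An open set disjoint from \<open>P b\<close> that contains the unit mass at
    \<open>x b\<close>: it witnesses that \<open>P b\<close> is not dense.\<close>
  define Q where "Q b = {\<mu> \<in> measures_of_order n. (\<integral>y. f b y \<partial>\<mu>) \<in> {1 - \<eta><..}}" for b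
  have int: "integrable \<mu> (f b)" if "\<mu> \<in> measures_of_order n" for \<mu> b
    using measures_of_orderD[OF that] by (intro integrable_continuous_compact[OF X f_cont])
  have P_open: "openin ?Y (P b)" and Q_open: "openin ?Y (Q b)" for b
    unfolding P_def Q_def by (intro openin_integral_vimage f_cont; simp)+
  have cover: "P True \<union> P False = topspace ?Y"
  proof -
    have "\<mu> \<in> P True \<or> \<mu> \<in> P False" if \<mu>: "\<mu> \<in> measures_of_order n" for \<mu>
    proof -
      interpret prob_space \<mu> by (rule measures_of_orderD(2)[OF \<mu>])
      have "(\<integral>y. f True y \<partial>\<mu>) + (\<integral>y. f False y \<partial>\<mu>) = (\<integral>y. f True y + f False y \<partial>\<mu>)"
        using int[OF \<mu>] by simp
      also have "\<dots> \<le> (\<integral>y. 1 \<partial>\<mu>)"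
        using int[OF \<mu>] f_sum by (intro integral_mono) auto
      also have "\<dots> = 1" by (simp add: prob_space)
      finally show ?thesis using \<mu> \<eta> by (auto simp: P_def)
    qed
    then show ?thesis by (auto simp: topspace_measure_space_of_order P_def)
  qed
  obtain k where k: "k > 0" "\<And>y :: nat \<Rightarrow> 'a. empirical_measure k y \<in> measures_of_order n"
    using empirical_measure_in_measures_of_order[OF n] by blast
  have dense: "?Y closure_of P b \<noteq> topspace ?Y" for b
  proof -
    have "f b \<in> borel_measurable borel" by (rule borel_measurable_continuous_onI[OF f_cont])
    then have "(\<integral>y. f b y \<partial>empirical_measure k (\<lambda>_. x b)) = 1"
      using k(1) by (simp add: integral_empirical_measure) (simp add: f_def)
    then have mem: "empirical_measure k (\<lambda>_. x b) \<in> Q b"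
      using k(2) \<eta> by (simp add: Q_def)
    have "Q b \<inter> ?Y closure_of P b = {}"
    proof -
      have "Q b \<inter> P b = {}" by (auto simp: P_def Q_def)
      then show ?thesis using openin_Int_closure_of_eq_empty[OF Q_open] by blast
    qed
    with mem show ?thesis
      using openin_subset[OF Q_open[of b]] by blast
  qed
  have S: "induced_map T \<in> topspace ?Y \<rightarrow> topspace ?Y"
    using induced_map_in_measures_of_order[OF T n] by (simp add: topspace_measure_space_of_order)
  have "standard_cover ?Y (range P)"
    unfolding standard_cover_def open_cover_def range_bool_eq
    using cover dense P_open by (intro exI[of _ "P True"] exI[of _ "P False"]) auto
  with UPE have "cover_entropy ?Y (induced_map T) (range P) > 0"
    by (simp add: UPE_def)
  then have "positive_density (independence_sets (induced_map T) (topspace ?Y) (\<lambda>b. topspace ?Y - P b))"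
    by (rule positive_density_if_entropy_pos[OF S cover])
  then obtain c where c: "c > 0" "\<And>m. m > 0 \<Longrightarrow>
      \<exists>J\<in>independence_sets (induced_map T) (topspace ?Y) (\<lambda>b. topspace ?Y - P b).
        J \<subseteq> {..<m} \<and> c * real m \<le> real (card J)"
    unfolding positive_density_def by blast
  have "0 < cover_entropy euclidean T (range W)"
  proof (rule entropy_pos_if_almost_independent[OF _ _ tail \<eta>(1) c(1)])
    fix m :: nat assume "m > 0"
    then obtain J where J: "J \<in> independence_sets (induced_map T) (topspace ?Y) (\<lambda>b. topspace ?Y - P b)"
        "J \<subseteq> {..<m}" "c * real m \<le> real (card J)"
      using c(2) by blast
    have finJ: "finite J" using J(2) finite_subset by blast
    have "\<exists>y\<in>topspace euclidean. (1 - \<eta>) * real (card J) \<le> real (card {j \<in> J. (T ^^ j) y \<notin> W (\<sigma> j)})"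
      for \<sigma>
    proof -
      obtain \<mu> where \<mu>: "\<mu> \<in> measures_of_order n"
          "\<forall>j\<in>J. (induced_map T ^^ j) \<mu> \<in> topspace ?Y - P (\<sigma> j)"
        using J(1) unfolding mem_independence_sets_iff topspace_measure_space_of_order by blast
      note \<mu>' = measures_of_orderD[OF \<mu>(1)]
      interpret prob_space \<mu> by (rule \<mu>')
      have fT: "integrable \<mu> (\<lambda>y. f (\<sigma> j) ((T ^^ j) y))" for j
        using continuous_on_compose2[OF f_cont continuous_on_funpow[OF T]] \<mu>'
        by (intro integrable_continuous_compact[OF X]) auto
      have "1 - \<eta> \<le> (\<integral>y. f (\<sigma> j) ((T ^^ j) y) \<partial>\<mu>)" if "j \<in> J" for j
        using \<mu>(2) that integral_induced_map_funpow[OF T \<mu>'(1) f_cont]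
        by (auto simp: P_def topspace_measure_space_of_order)
      then have "(\<Sum>j\<in>J. 1 - \<eta>) \<le> (\<Sum>j\<in>J. \<integral>y. f (\<sigma> j) ((T ^^ j) y) \<partial>\<mu>)"
        by (rule sum_mono)
      also have "\<dots> = (\<integral>y. (\<Sum>j\<in>J. f (\<sigma> j) ((T ^^ j) y)) \<partial>\<mu>)"
        using fT by (simp add: Bochner_Integration.integral_sum)
      finally have le: "(1 - \<eta>) * real (card J) \<le> (\<integral>y. (\<Sum>j\<in>J. f (\<sigma> j) ((T ^^ j) y)) \<partial>\<mu>)"
        by (simp add: mult.commute)
      \<comment> \<open>Negation turns the choice of a point not above the mean into one not below
        it.\<close>
      have "integrable \<mu> (\<lambda>y. - (\<Sum>j\<in>J. f (\<sigma> j) ((T ^^ j) y)))"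
        using fT by (intro Bochner_Integration.integrable_minus Bochner_Integration.integrable_sum)
      then obtain y where "- (\<Sum>j\<in>J. f (\<sigma> j) ((T ^^ j) y))
          \<le> (\<integral>y. - (\<Sum>j\<in>J. f (\<sigma> j) ((T ^^ j) y)) \<partial>\<mu>)"
        by (rule exists_le_expectation)
      with le have "(1 - \<eta>) * real (card J) \<le> (\<Sum>j\<in>J. f (\<sigma> j) ((T ^^ j) y))"
        by simp
      \<comment> \<open>Each bump is at most the indicator of the complement of its \<open>W\<close>
        set, so the sum bounds the number of correct times.\<close>
      also have "\<dots> \<le> (\<Sum>j\<in>J. if (T ^^ j) y \<notin> W (\<sigma> j) then 1 else 0)"
        using f_zero f_range by (intro sum_mono) auto
      also have "\<dots> = real (card {j \<in> J. (T ^^ j) y \<notin> W (\<sigma> j)})"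
        using finJ by (simp add: sum.If_cases Int_def)
      finally show ?thesis by auto
    qed
    with J(2,3) show "\<exists>J\<subseteq>{..<m}. c * real m \<le> real (card J) \<and> (\<forall>\<sigma>. \<exists>y\<in>topspace euclidean.
        (1 - \<eta>) * real (card J) \<le> real (card {j \<in> J. (T ^^ j) y \<notin> W (\<sigma> j)}))"
      by blast
  qed (use W(1) in auto)
  then show "0 < cover_entropy euclidean T \<U>" by (simp add: W(2))
qed

theorem theorem4:
  fixes T :: "'a::metric_space \<Rightarrow> 'a"
  assumes "compact (UNIV :: 'a set)"
    and "continuous_on UNIV T"
    and "surj T"
  shows "(UPE euclidean T \<longleftrightarrow>
            (\<exists>n::enat. 1 \<le> n \<and> UPE (measure_space_of_order n) (induced_map T))) \<and>
         (UPE euclidean T \<longleftrightarrow>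
            (\<forall>n::enat. 1 \<le> n \<longrightarrow> UPE (measure_space_of_order n) (induced_map T)))"
  using UPE_induced_map[OF assms(1,2)] UPE_if_UPE_induced_map[OF assms(1,2)] by blast

end
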